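(* Let $n\ge 2$, $N\ge 1$, $R>0$, and let $f$ be a $C^\infty$ function in a neighborhood of the closed ball $\overline{B_R}\subset\mathbb{R}^n$. For all $k=0,1,2,\dots$ and $\ell=1,\dots,d_k$ let interpolation knots $$0\le r_{k,\ell,1}<r_{k,\ell,2}<\dots<r_{k,\ell,N}\le R$$ be given. Let $\|f|_N$ be the seminorm defined in the context. If $$R\,\|f|_N<1,$$ then there exists a unique polyharmonic interpolation function $h$ of order $N$ for $f$ and the knots $\{r_{k,\ell,j}\}$ (as defined in the context); the function $\theta\mapsto h(r\theta)$ belongs to $L_2(\mathbb{S}^{n-1})$ for every $r\le R$, and $h$ belongs to $L_2(B_R)$. Moreover, under the same assumption $R\,\|f|_N<1$, the error of interpolation satisfies, with a constant $C>0$ and for every $0\le r\le R$, $$\left\|f(r\theta)-h(r\theta)\right\|_{L_2(\mathbb{S}^{n-1})}\le C\,R^{2N}\,\|f|_N^{\,N+1},$$ where the norm is taken with respect to $\theta\in\mathbb{S}^{n-1}$.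
   Context: $B_R=\{x\in\mathbb{R}^n: |x|<R\}$; write $x=r\theta$ with $r=|x|$, $\theta\in\mathbb{S}^{n-1}$. For each $k\ge 0$, $d_k$ is the dimension of the space of harmonic homogeneous polynomials of degree $k$ in $\mathbb{R}^n$, and $Y_{k,\ell}$, $\ell=1,\dots,d_k$, is a basis of this space, orthonormal with respect to the scalar product $\frac{1}{\omega_{n-1}}\int_{\mathbb{S}^{n-1}}u(\theta)v(\theta)\,d\theta$, where $\omega_{n-1}$ is the area of $\mathbb{S}^{n-1}$. Every $f$ that is $C^\infty$ in a neighborhood of $\overline{B_R}$ has an expansion $$f(x)=\sum_{k=0}^\infty\sum_{\ell=1}^{d_k} f_{k,\ell}(r^2)\,r^k\,Y_{k,\ell}(\theta),\qquad f_{k,\ell}\in C^\infty([0,R^2]);$$ this defines the functions $f_{k,\ell}$ (known fact). Seminorm: $$\|f|_N:=\overline{\lim_{k,\ell}}\ \sup_{0\le t\le R^2}\left|\frac{1}{N!}\frac{d^N}{dt^N}f_{k,\ell}(t)\right|^{\frac{1}{k+N+1}},$$ where the upper limit is over the pairs $(k,\ell)$, $1\le\ell\le d_k$, as $k\to\infty$. A function $h$ is polyharmonic of order $N$ in a domain $D$ if $\Delta^N h=0$ in $D$. Such a function on $B_R$ has an expansion $h(x)=\sum_{k=0}^\infty\sum_{\ell=1}^{d_k}h_{k,\ell}(r^2)\,r^k\,Y_{k,\ell}(\theta)$ with $h_{k,\ell}$ polynomials of degree $\le N-1$. Polyharmonic interpolation: for every $(k,\ell)$ let $h_{k,\ell}$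 be the polynomial of degree $\le N-1$ determined by $$h_{k,\ell}(r_{k,\ell,j}^2)=f_{k,\ell}(r_{k,\ell,j}^2),\qquad j=1,\dots,N.$$ If the series $h(x)=\sum_{k=0}^\infty\sum_{\ell=1}^{d_k}h_{k,\ell}(r^2)\,r^k\,Y_{k,\ell}(\theta)$ converges (here in the $L_2$ sense, on $\mathbb{S}^{n-1}$ for each fixed $r\le R$ and on $B_R$), then $h$ is called the polyharmonic interpolant (polyharmonic interpolation function) of order $N$ of $f$.
   Formalization: The error estimate is stated only when the seminorm of f is positive; as printed it fails when the seminorm is 0, e.g. for f(x)=|x|^{2N}, where the right side is 0 but the interpolation error is not. Existence, uniqueness and L_2 membership are unconditional. *)

theory Defs
  imports "HOL-Analysis.Analysis" "HOL-Library.Function_Algebras"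
begin

section \<open>Smooth functions\<close>

definition partial :: "'n::finite \<Rightarrow> (real^'n \<Rightarrow> real) \<Rightarrow> real^'n \<Rightarrow> real" where
  "partial i f x = frechet_derivative f (at x) (axis i 1)"

fun Ck_on :: "nat \<Rightarrow> (real^'n::finite) set \<Rightarrow> (real^'n \<Rightarrow> real) \<Rightarrow> bool" where
  "Ck_on 0 U f \<longleftrightarrow> continuous_on U f"
| "Ck_on (Suc m) U f \<longleftrightarrow> f differentiable_on U \<and> (\<forall>i. Ck_on m U (partial i f))"

text \<open>Only meant for open \<open>U\<close>, since \<^const>\<open>partial\<close> uses two-sided derivatives.\<close>

definition smooth_on :: "(real^'n::finite) set \<Rightarrow> (real^'n \<Rightarrow> real) \<Rightarrow> bool" where
  "smooth_on U f \<longleftrightarrow> (\<forall>m. Ck_on m U f)"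

definition laplacian :: "(real^'n::finite \<Rightarrow> real) \<Rightarrow> real^'n \<Rightarrow> real" where
  "laplacian f x = (\<Sum>i\<in>UNIV. partial i (partial i f) x)"

text \<open>Iterated derivatives on a nondegenerate closed interval, one-sided at the end points.\<close>

definition nderiv_within :: "nat \<Rightarrow> real set \<Rightarrow> (real \<Rightarrow> real) \<Rightarrow> real \<Rightarrow> real" where
  "nderiv_within m S g = ((\<lambda>u t. vector_derivative u (at t within S)) ^^ m) g"

definition smooth_within :: "real set \<Rightarrow> (real \<Rightarrow> real) \<Rightarrow> bool" where
  "smooth_within S g \<longleftrightarrow> (\<forall>m. nderiv_within m S g differentiable_on S)"

section \<open>Square-integrable functions and the surface measure of the sphere\<close>

definition square_integrable :: "'a measure \<Rightarrow> ('a \<Rightarrow> real) \<Rightarrow> bool" where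
  "square_integrable M u \<longleftrightarrow> u \<in> borel_measurable M \<and> integrable M (\<lambda>x. (u x)\<^sup>2)"

definition L2_norm_on :: "'a measure \<Rightarrow> ('a \<Rightarrow> real) \<Rightarrow> real" where
  "L2_norm_on M u = sqrt (\<integral>x. (u x)\<^sup>2 \<partial>M)"

definition L2_tendsto :: "'a measure \<Rightarrow> (nat \<Rightarrow> 'a \<Rightarrow> real) \<Rightarrow> ('a \<Rightarrow> real) \<Rightarrow> bool" where
  "L2_tendsto M u v \<longleftrightarrow>
     (\<forall>K. square_integrable M (u K)) \<and> square_integrable M v \<and>
     (\<lambda>K. L2_norm_on M (\<lambda>x. u K x - v x)) \<longlonglongrightarrow> 0"

text \<open>
  The surface measure of a Borel set \<open>A\<close> of the unit sphere is \<open>n\<close> times the volume of the cone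
  over \<open>A\<close> in the unit ball; for \<open>x \<noteq> 0\<close>, \<^term>\<open>sgn x\<close> is the direction \<open>x / |x|\<close>.
\<close>

definition sphere_measure :: "(real^'n::finite) measure" where
  "sphere_measure =
     distr (scale_measure (of_nat CARD('n)) (restrict_space lborel (ball 0 1 - {0})))
       (restrict_space borel (sphere 0 1)) sgn"

lemma space_sphere_measure [simp]: "space sphere_measure = sphere 0 1"
  by (simp add: sphere_measure_def space_restrict_space)

lemma sets_sphere_measure [simp, measurable_cong]:
  "sets sphere_measure = sets (restrict_space borel (sphere 0 1))"
  by (simp add: sphere_measure_def)

lemma emeasure_sphere_measure:
  fixes A :: "(real^'n::finite) set"
  assumes "A \<in> sets borel" "A \<subseteq> sphere 0 1"
  shows "emeasure sphere_measure A =
           of_nat CARD('n) * emeasure lborel {x \<in> ball 0 1 - {0}. sgn x \<in> A}"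
proof -
  let ?B = "ball 0 1 - {0} :: (real^'n) set"
  let ?M = "scale_measure (of_nat CARD('n)) (restrict_space lborel ?B)"
  have B: "?B \<in> sets borel" by simp
  have sgn: "(sgn :: real^'n \<Rightarrow> _) \<in> borel_measurable borel"
    unfolding sgn_div_norm[abs_def] by measurable
  have "sgn \<in> measurable (restrict_space lborel ?B) (restrict_space borel (sphere 0 1))"
    using sgn by (intro measurable_restrict_space3) (auto simp: norm_sgn)
  then have m: "sgn \<in> measurable ?M (restrict_space borel (sphere 0 1))"
    by (simp add: measurable_def space_scale_measure)
  have A: "A \<in> sets (restrict_space borel (sphere 0 1))"
    using assms by (subst sets_restrict_space_iff) auto
  have "sgn -` A \<inter> space ?M = {x \<in> ?B. sgn x \<in> A}"
    by (auto simp: space_scale_measure space_restrict_space)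
  moreover have "emeasure (restrict_space lborel ?B) {x \<in> ?B. sgn x \<in> A} =
      emeasure lborel {x \<in> ?B. sgn x \<in> A}"
    using B by (intro emeasure_restrict_space) auto
  ultimately show ?thesis
    by (simp only: sphere_measure_def emeasure_distr[OF m A] emeasure_scale_measure)
qed

section \<open>Harmonic homogeneous polynomials\<close>

interpretation fun_space: vector_space "\<lambda>(c::real) (p :: 'a \<Rightarrow> real) x. c * p x"
  by standard (auto simp: fun_eq_iff algebra_simps)

definition harmonic_homogeneous :: "nat \<Rightarrow> (real^'n::finite \<Rightarrow> real) set" where
  "harmonic_homogeneous k =
     {p. real_polynomial_function p \<and> (\<forall>c x. p (c *\<^sub>R x) = c ^ k * p x) \<and>
         (\<forall>x. laplacian p x = 0)}"

definition harmonic_dim :: "'n::finite itself \<Rightarrow> nat \<Rightarrow> nat" where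
  "harmonic_dim _ k = fun_space.dim (harmonic_homogeneous k :: (real^'n \<Rightarrow> real) set)"

definition sphere_inner :: "(real^'n::finite \<Rightarrow> real) \<Rightarrow> (real^'n \<Rightarrow> real) \<Rightarrow> real" where
  "sphere_inner u v =
     (\<integral>\<theta>. u \<theta> * v \<theta> \<partial>sphere_measure) / measure (sphere_measure :: (real^'n) measure) (sphere 0 1)"

definition orthonormal_harmonic_basis :: "(nat \<Rightarrow> nat \<Rightarrow> real^'n::finite \<Rightarrow> real) \<Rightarrow> bool" where
  "orthonormal_harmonic_basis Y \<longleftrightarrow>
     (\<forall>k. fun_space.span (Y k ` {1..harmonic_dim TYPE('n) k}) = harmonic_homogeneous k \<and>
          (\<forall>l\<in>{1..harmonic_dim TYPE('n) k}. \<forall>m\<in>{1..harmonic_dim TYPE('n) k}.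
             sphere_inner (Y k l) (Y k m) = (if l = m then 1 else 0)))"

section \<open>Expansions in spherical harmonics\<close>

text \<open>
  With \<open>x = r \<theta>\<close> this is the partial sum over \<open>k < K\<close> of \<open>c k l (r\<^sup>2) r\<^sup>k Y k l \<theta>\<close>.
  At \<open>x = 0\<close>, where \<^term>\<open>sgn x = 0\<close>, only the term \<open>k = 0\<close> survives, and \<open>Y 0 l\<close> is constant.
\<close>

definition harmonic_partial_sum ::
  "(nat \<Rightarrow> nat \<Rightarrow> real^'n::finite \<Rightarrow> real) \<Rightarrow> (nat \<Rightarrow> nat \<Rightarrow> real \<Rightarrow> real) \<Rightarrow> nat \<Rightarrow> real^'n \<Rightarrow> real" where
  "harmonic_partial_sum Y c K x =
     (\<Sum>k<K. \<Sum>l=1..harmonic_dim TYPE('n) k. c k l ((norm x)\<^sup>2) * norm x ^ k * Y k l (sgn x))"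

text \<open>
  The expansion of a function that is smooth near the closed ball converges uniformly there.
  This property determines \<open>c k l\<close> on \<open>[0, R\<^sup>2]\<close> for \<open>1 \<le> l \<le> d\<^sub>k\<close>.
\<close>

definition harmonic_coefficients ::
  "(nat \<Rightarrow> nat \<Rightarrow> real^'n::finite \<Rightarrow> real) \<Rightarrow> real \<Rightarrow> (real^'n \<Rightarrow> real) \<Rightarrow>
   (nat \<Rightarrow> nat \<Rightarrow> real \<Rightarrow> real) \<Rightarrow> bool" where
  "harmonic_coefficients Y R f c \<longleftrightarrow>
     (\<forall>k. \<forall>l\<in>{1..harmonic_dim TYPE('n) k}. smooth_within {0..R\<^sup>2} (c k l)) \<and>
     uniform_limit (cball 0 R) (harmonic_partial_sum Y c) f sequentially"

text \<open>The filter on pairs \<open>(k, l)\<close>, \<open>1 \<le> l \<le> d\<^sub>k\<close>, as \<open>k\<close> tends to infinity.\<close>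

definition harmonic_index_filter :: "'n::finite itself \<Rightarrow> (nat \<times> nat) filter" where
  "harmonic_index_filter n =
     inf (filtercomap fst at_top) (principal {(k, l). l \<in> {1..harmonic_dim n k}})"

text \<open>
  The upper limit ignores finitely many \<open>k\<close>, so it vanishes for functions with a finite expansion,
  such as polynomials. An error estimate whose right-hand side is a multiple of a power of the
  seminorm needs it to be positive: for \<open>f x = |x| ^ (2 * N)\<close> it is \<open>0\<close>, but
  \<open>t ^ N\<close> differs from its Lagrange interpolation polynomial of degree less than \<open>N\<close>.
\<close>

definition harmonic_seminorm ::
  "'n::finite itself \<Rightarrow> real \<Rightarrow> nat \<Rightarrow> (nat \<Rightarrow> nat \<Rightarrow> real \<Rightarrow> real) \<Rightarrow> ereal" where
  "harmonic_seminorm n R N c =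
     Limsup (harmonic_index_filter n)
       (\<lambda>(k, l). SUP t\<in>{0..R\<^sup>2}.
          ereal (root (k + N + 1) \<bar>1 / fact N * nderiv_within N {0..R\<^sup>2} (c k l) t\<bar>))"

section \<open>Polyharmonic interpolation\<close>

definition admissible_knots ::
  "'n::finite itself \<Rightarrow> real \<Rightarrow> nat \<Rightarrow> (nat \<Rightarrow> nat \<Rightarrow> nat \<Rightarrow> real) \<Rightarrow> bool" where
  "admissible_knots n R N \<rho> \<longleftrightarrow>
     (\<forall>k. \<forall>l\<in>{1..harmonic_dim n k}.
        (\<forall>j\<in>{1..N}. 0 \<le> \<rho> k l j \<and> \<rho> k l j \<le> R) \<and> strict_mono_on {1..N} (\<rho> k l))"

definition polyharmonic_interpolant ::
  "(nat \<Rightarrow> nat \<Rightarrow> real^'n::finite \<Rightarrow> real) \<Rightarrow> real \<Rightarrow> nat \<Rightarrow> (nat \<Rightarrow> nat \<Rightarrow> real \<Rightarrow> real) \<Rightarrow>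
   (nat \<Rightarrow> nat \<Rightarrow> nat \<Rightarrow> real) \<Rightarrow> (real^'n \<Rightarrow> real) \<Rightarrow> bool" where
  "polyharmonic_interpolant Y R N c \<rho> h \<longleftrightarrow>
     (\<exists>p :: nat \<Rightarrow> nat \<Rightarrow> real poly.
        (\<forall>k. \<forall>l\<in>{1..harmonic_dim TYPE('n) k}. degree (p k l) \<le> N - 1 \<and>
           (\<forall>j\<in>{1..N}. poly (p k l) ((\<rho> k l j)\<^sup>2) = c k l ((\<rho> k l j)\<^sup>2))) \<and>
        (\<forall>r\<in>{0..R}. L2_tendsto sphere_measure
           (\<lambda>K \<theta>. harmonic_partial_sum Y (\<lambda>k l. poly (p k l)) K (r *\<^sub>R \<theta>)) (\<lambda>\<theta>. h (r *\<^sub>R \<theta>))) \<and>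
        L2_tendsto (restrict_space lborel (ball 0 R))
           (harmonic_partial_sum Y (\<lambda>k l. poly (p k l))) h)"

end

theory Submission
  imports Defs
begin

text \<open>
  Let \<open>p k l\<close> interpolate \<open>c k l\<close> at the squared knots, and let \<open>g k\<close> be the sum over \<open>l\<close> of
  \<open>(c k l - p k l) (|x|\<^sup>2) Y k l x\<close>. The Lagrange error formula bounds \<open>c k l - p k l\<close> on \<open>[0, R\<^sup>2]\<close> by
  \<open>q ^ (k + N + 1) * R ^ (2 * N)\<close> for large \<open>k\<close>, where \<open>q\<close> lies strictly between the seminorm and \<open>1 / R\<close>. Since
  \<open>d\<^sub>k \<le> (k + 1) ^ n\<close>, the \<open>L\<^sub>2\<close> norms of the \<open>g k\<close>, on all spheres of radius at most \<open>R\<close> and on the ball, are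
  dominated by a single summable sequence. So the series of the \<open>g k\<close> converges absolutely in \<open>L\<^sub>2\<close>, and
  \<open>h = f - (\<Sum>k. g k)\<close> is the interpolant, because the expansion of \<open>f\<close> converges uniformly.
\<close>

section \<open>Polynomial interpolation\<close>

text \<open>A single function \<open>h\<close> has to be the limit on every sphere and on the ball,
  whereas limits taken separately in the various \<open>L\<^sub>2\<close> spaces would be unrelated
  classes. Hence the series of the \<open>g k\<close> is summed pointwise: where it diverges,
  \<open>suminf\<close> has an unspecified value, and for each of the measures involved this happens
  only on a null set.

  The seminorm is an upper limit, so it gives no quantitative bound for finitely many degrees
  \<open>k\<close>. For these the error is bounded only by continuity on a compact interval, and the
  sum of the dominating sequence therefore depends on \<open>f\<close> and on the knots. What the
  error estimate exploits is that this sum does not depend on \<open>r\<close>: a bound uniform in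
  \<open>r\<close> takes the required form once \<open>C\<close> is obtained by dividing it by
  \<open>R ^ (2 * N)\<close> and by the power of the seminorm, and this division asks for a positive
  seminorm.\<close>

lemma interpolation_poly_exists:
  fixes g :: "'a::field \<Rightarrow> 'a"
  assumes "finite A"
  shows "\<exists>p. degree p \<le> card A - 1 \<and> (\<forall>x\<in>A. poly p x = g x)"
  using assms
proof (induction A)
  case empty
  show ?case by (intro exI[of _ 0]) simp
next
  case (insert a A)
  then obtain p where p: "degree p \<le> card A - 1" "\<And>x. x \<in> A \<Longrightarrow> poly p x = g x"
    by blast
  let ?w = "\<Prod>b\<in>A. [:- b, 1:]"
  have w: "poly ?w a \<noteq> 0" "\<And>x. x \<in> A \<Longrightarrow> poly ?w x = 0" "degree ?w = card A"
    using insert.hyps by (auto simp: poly_prod degree_prod_eq_sum_degree)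
  \<comment> \<open>Newton's form: \<open>?w\<close> vanishes at the old nodes, so a multiple of it
    can correct the value at \<open>a\<close> alone.\<close>
  let ?p = "p + smult ((g a - poly p a) / poly ?w a) ?w"
  have "degree ?p \<le> card A"
    using p(1) w(3) by (intro degree_add_le) (auto intro: order_trans[OF degree_smult_le])
  moreover have "\<forall>x\<in>insert a A. poly ?p x = g x"
    using p(2) w by auto
  ultimately show ?case
    using insert.hyps by (intro exI[of _ ?p]) simp
qed

text \<open>Rolle between neighbouring zeros. Removing the largest zero and inducting leaves one new
  zero to find, between the two largest elements of \<open>Z\<close>. Keeping the zeros of
  \<open>f'\<close> strictly below \<open>Max Z\<close> makes the new one differ from those given by
  the induction hypothesis.\<close>

lemma derivative_zeros:
  fixes f :: "real \<Rightarrow> real"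
  assumes "\<And>t. t \<in> {a..b} \<Longrightarrow> (f has_real_derivative f' t) (at t within {a..b})"
    and "finite Z" "card Z = Suc m" "Z \<subseteq> {a..b}" "\<And>z. z \<in> Z \<Longrightarrow> f z = 0"
  shows "\<exists>Z'. finite Z' \<and> card Z' = m \<and> Z' \<subseteq> {..<Max Z} \<inter> {a..b} \<and> (\<forall>z\<in>Z'. f' z = 0)"
  using assms(2-)
proof (induction m arbitrary: Z)
  case 0
  show ?case by (intro exI[of _ "{}"]) simp
next
  case (Suc m)
  let ?c = "Max Z" and ?A = "Z - {Max Z}"
  let ?d = "Max ?A"
  have c: "?c \<in> Z" using Suc.prems by (intro Max_in) auto
  have A: "finite ?A" "card ?A = Suc m" "?A \<subseteq> {a..b}" "?A \<noteq> {}"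
  proof -
    show "card ?A = Suc m" using Suc.prems c by (simp add: card_Diff_singleton)
    then show "?A \<noteq> {}" by (metis card.empty nat.distinct(1))
  qed (use Suc.prems in auto)
  have d: "?d \<in> ?A" using A by (intro Max_in) auto
  have dc: "?d < ?c"
    by (metis Diff_iff Max_ge Suc.prems(1) d order_less_le singletonI)
  obtain Z' where Z': "finite Z'" "card Z' = m" "Z' \<subseteq> {..<?d} \<inter> {a..b}" "\<forall>z\<in>Z'. f' z = 0"
    using Suc.IH[of ?A] A Suc.prems by blast
  have ab: "a \<le> ?d" "?c \<le> b" using c d Suc.prems by auto
  have "\<exists>z. ?d < z \<and> z < ?c \<and> (\<lambda>v. f' z * v) = (\<lambda>v. 0)"
  proof (rule Rolle_deriv)
    show "f ?d = f ?c" using c d Suc.prems by auto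
    have "continuous_on {a..b} f"
      using assms(1) by (rule DERIV_continuous_on)
    then show "continuous_on {?d..?c} f"
      using ab by (auto intro: continuous_on_subset)
    show "(f has_derivative (\<lambda>v. f' z * v)) (at z)" if "?d < z" "z < ?c" for z
    proof -
      have "(f has_real_derivative f' z) (at z within {a..b})"
        using assms(1)[of z] that ab by simp
      moreover have "at z within {a..b} = at z"
        using that ab by (intro at_within_Icc_at) auto
      ultimately show ?thesis by (simp add: has_field_derivative_def)
    qed
  qed (use dc in auto)
  then obtain z where z: "?d < z" "z < ?c" "f' z = 0"
    by (metis mult.right_neutral)
  have "z \<notin> Z'" using Z' z by force
  then show ?case
    using Z' z ab dc by (intro exI[of _ "insert z Z'"]) auto
qed

text \<open>Each differentiation costs one zero, so \<open>n + 1\<close> zeros leave one after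
  \<open>n\<close> steps. Giving the derivatives as a family \<open>D\<close> lets the induction
  shift the index, and covers one-sided derivatives at the end points.\<close>

lemma iterated_derivative_zero:
  fixes D :: "nat \<Rightarrow> real \<Rightarrow> real"
  assumes "\<And>m t. m < n \<Longrightarrow> t \<in> {a..b} \<Longrightarrow> (D m has_real_derivative D (Suc m) t) (at t within {a..b})"
    and "finite Z" "card Z = Suc n" "Z \<subseteq> {a..b}" "\<And>z. z \<in> Z \<Longrightarrow> D 0 z = 0"
  shows "\<exists>t\<in>{a..b}. D n t = 0"
  using assms
proof (induction n arbitrary: D Z)
  case 0
  then obtain z where "Z = {z}" by (auto simp: card_Suc_eq)
  with 0 show ?case by auto
next
  case (Suc n)
  obtain Z' where Z': "finite Z'" "card Z' = Suc n" "Z' \<subseteq> {..<Max Z} \<inter> {a..b}" "\<forall>z\<in>Z'. D 1 z = 0"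
    using derivative_zeros[of a b "D 0" "D 1" Z "Suc n"] Suc.prems by auto
  have "\<exists>t\<in>{a..b}. (\<lambda>m. D (Suc m)) n t = 0"
    by (rule Suc.IH[of _ Z']) (use Z' Suc.prems in auto)
  then show ?case by simp
qed

lemma higher_pderiv_top_degree:
  fixes p :: "'a::{comm_semiring_1,semiring_no_zero_divisors,semiring_char_0} poly"
  assumes "degree p \<le> n"
  shows "(pderiv ^^ n) p = [:fact n * coeff p n:]"
  using assms by (intro poly_eqI) (auto simp: coeff_higher_pderiv coeff_pCons pochhammer_fact coeff_eq_0 split: nat.split)

text \<open>
  For \<open>x\<close> outside the nodes, the error minus the multiple of the node polynomial that makes it
  vanish at \<open>x\<close> has \<open>card A + 1\<close> zeros, to which the iterated Rolle theorem applies.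
\<close>

lemma interpolation_error:
  fixes D :: "nat \<Rightarrow> real \<Rightarrow> real"
  assumes D: "\<And>m t. m < card A \<Longrightarrow> t \<in> {a..b} \<Longrightarrow> (D m has_real_derivative D (Suc m) t) (at t within {a..b})"
    and A: "finite A" "A \<subseteq> {a..b}" "A \<noteq> {}" and x: "x \<in> {a..b}"
    and p: "degree p < card A" "\<And>z. z \<in> A \<Longrightarrow> poly p z = D 0 z"
  shows "\<exists>t\<in>{a..b}. D 0 x - poly p x = D (card A) t / fact (card A) * (\<Prod>z\<in>A. x - z)"
proof (cases "x \<in> A")
  case True
  then show ?thesis using A p(2) by (intro bexI[of _ x]) auto
next
  case False
  let ?w = "\<Prod>z\<in>A. [:- z, 1:]"
  have w: "poly ?w y = (\<Prod>z\<in>A. y - z)" for y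
    by (simp add: poly_prod)
  have wx: "poly ?w x \<noteq> 0" using A False by (simp add: w)
  have dw: "degree ?w = card A" by (simp add: degree_prod_eq_sum_degree)
  have lw: "coeff ?w (card A) = 1"
    using lead_coeff_prod[of "\<lambda>z. [:- z, 1:]" A] dw by simp
  define K where "K = (D 0 x - poly p x) / poly ?w x"
  define s where "s = p + smult K ?w"
  have "\<exists>t\<in>{a..b}. D (card A) t - poly ((pderiv ^^ card A) s) t = 0"
  proof (rule iterated_derivative_zero[of "card A" a b "\<lambda>m t. D m t - poly ((pderiv ^^ m) s) t" "insert x A"])
    show "((\<lambda>t. D m t - poly ((pderiv ^^ m) s) t) has_real_derivative
        D (Suc m) t - poly ((pderiv ^^ Suc m) s) t) (at t within {a..b})"
      if "m < card A" "t \<in> {a..b}" for m t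
      using D[OF that] by (auto intro!: derivative_eq_intros)
    show "D 0 z - poly ((pderiv ^^ 0) s) z = 0" if "z \<in> insert x A" for z
      using that p(2) wx A by (auto simp: s_def K_def w)
  qed (use A x False in auto)
  then obtain t where t: "t \<in> {a..b}" "D (card A) t = poly ((pderiv ^^ card A) s) t" by auto
  \<comment> \<open>The degree of \<open>p\<close> is too small to contribute, and the node
    polynomial is monic of degree \<open>card A\<close>, so the top derivative is a constant that
    reveals \<open>K\<close>.\<close>
  have "(pderiv ^^ card A) s = [:fact (card A) * K:]"
    using p(1) lw dw coeff_eq_0[OF p(1)]
    by (subst higher_pderiv_top_degree) (auto simp: s_def intro!: degree_add_le intro: order_trans[OF degree_smult_le])
  then have "D (card A) t / fact (card A) = K" using t by simp
  then show ?thesis using t wx by (intro bexI[of _ t]) (auto simp: K_def w)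
qed

section \<open>Convergence in \<open>L\<^sub>2\<close>\<close>

text \<open>
  Weighting the Cauchy--Schwarz inequality by \<open>a k\<close> gives \<open>(\<Sum>k. g k x)\<^sup>2 \<le> (\<Sum>k. a k) * (\<Sum>k. (g k x)\<^sup>2 / a k)\<close>, and
  the last sum can be integrated termwise; this replaces the completeness of \<open>L\<^sub>2\<close>.
\<close>

lemma L2_weighted_series:
  fixes g :: "nat \<Rightarrow> 'a \<Rightarrow> real"
  assumes g [measurable]: "\<And>k. g k \<in> borel_measurable M"
    and a: "\<And>k. a k > 0" "summable a" and W: "W \<ge> 0"
    and le: "\<And>k. (\<integral>\<^sup>+x. ennreal ((g k x)\<^sup>2) \<partial>M) \<le> ennreal (W * (a k)\<^sup>2)"
  shows "AE x in M. summable (\<lambda>k. g k x)"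
    and "(\<integral>\<^sup>+x. ennreal ((\<Sum>k. g k x)\<^sup>2) \<partial>M) \<le> ennreal (W * (\<Sum>k. a k)\<^sup>2)"
proof -
  \<comment> \<open>Dividing by the weight turns the bound \<open>W * (a k)\<^sup>2\<close> on the
    integrals into \<open>W * a k\<close>, which is still summable.\<close>
  define u where "u k x = (g k x)\<^sup>2 / a k" for k x
  have u [measurable]: "u k \<in> borel_measurable M" for k
    unfolding u_def by measurable
  have u0: "u k x \<ge> 0" for k x using a(1)[of k] by (simp add: u_def)
  have iu: "(\<integral>\<^sup>+x. ennreal (u k x) \<partial>M) \<le> ennreal (W * a k)" for k
  proof -
    have "(\<integral>\<^sup>+x. ennreal (u k x) \<partial>M) = (\<integral>\<^sup>+x. ennreal (1 / a k) * ennreal ((g k x)\<^sup>2) \<partial>M)"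
      using a(1)[of k] by (intro nn_integral_cong) (simp add: u_def flip: ennreal_mult)
    also have "\<dots> = ennreal (1 / a k) * (\<integral>\<^sup>+x. ennreal ((g k x)\<^sup>2) \<partial>M)"
      by (rule nn_integral_cmult) measurable
    also have "\<dots> \<le> ennreal (1 / a k) * ennreal (W * (a k)\<^sup>2)"
      by (rule mult_left_mono[OF le]) simp
    also have "\<dots> = ennreal (W * a k)"
      using a(1)[of k] W by (simp add: power2_eq_square flip: ennreal_mult)
    finally show ?thesis .
  qed
  have "(\<integral>\<^sup>+x. (\<Sum>k. ennreal (u k x)) \<partial>M) = (\<Sum>k. \<integral>\<^sup>+x. ennreal (u k x) \<partial>M)"
    by (rule nn_integral_suminf) measurable
  also have "\<dots> \<le> (\<Sum>k. ennreal (W * a k))"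
    by (intro suminf_le iu) auto
  also have "\<dots> = ennreal (W * (\<Sum>k. a k))"
    using a W by (subst suminf_ennreal2) (auto intro: summable_mult simp: suminf_mult less_imp_le)
  finally have U: "(\<integral>\<^sup>+x. (\<Sum>k. ennreal (u k x)) \<partial>M) \<le> ennreal (W * (\<Sum>k. a k))" .
  have "AE x in M. (\<Sum>k. ennreal (u k x)) \<noteq> \<infinity>"
    by (rule nn_integral_PInf_AE) (use U in \<open>auto simp: top_unique\<close>)
  then have su: "AE x in M. summable (\<lambda>k. u k x)"
    by eventually_elim (rule summable_suminf_not_top, use u0 in auto)
  \<comment> \<open>Either \<open>\<bar>g k x\<bar> \<le> a k\<close>, or
    \<open>\<bar>g k x\<bar> \<le> u k x\<close>; the sum of the two majorants is summable.\<close>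
  have s: "summable (\<lambda>k. g k x)" if "summable (\<lambda>k. u k x)" for x
  proof (rule summable_comparison_test'[where N = 0])
    show "summable (\<lambda>k. a k + u k x)" by (intro summable_add a that)
    show "norm (g k x) \<le> a k + u k x" for k
    proof (cases "\<bar>g k x\<bar> \<le> a k")
      case True then show ?thesis using u0[of k x] by simp
    next
      case False
      then have "\<bar>g k x\<bar> * a k \<le> \<bar>g k x\<bar> * \<bar>g k x\<bar>" by (intro mult_left_mono) auto
      then have "\<bar>g k x\<bar> \<le> u k x"
        using a(1)[of k] by (simp add: u_def field_simps power2_eq_square)
      then show ?thesis using a(1)[of k] by simp
    qed
  qed
  show "AE x in M. summable (\<lambda>k. g k x)"
    using su by eventually_elim (rule s)
  have sq: "(\<Sum>k. g k x)\<^sup>2 \<le> (\<Sum>k. a k) * (\<Sum>k. u k x)" if x: "summable (\<lambda>k. u k x)" for x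
  proof (rule LIMSEQ_le_const2)
    show "(\<lambda>K. (\<Sum>k<K. g k x)\<^sup>2) \<longlonglongrightarrow> (\<Sum>k. g k x)\<^sup>2"
      by (intro tendsto_power summable_LIMSEQ s x)
    have "(\<Sum>k<K. g k x)\<^sup>2 \<le> (\<Sum>k. a k) * (\<Sum>k. u k x)" for K
    proof -
      have "(\<Sum>k<K. g k x)\<^sup>2 = (\<Sum>k<K. sqrt (a k) * (g k x / sqrt (a k)))\<^sup>2"
        using a(1) by (simp add: less_imp_neq[symmetric])
      also have "\<dots> \<le> (\<Sum>k<K. (sqrt (a k))\<^sup>2) * (\<Sum>k<K. (g k x / sqrt (a k))\<^sup>2)"
        by (rule Cauchy_Schwarz_ineq_sum)
      also have "\<dots> = (\<Sum>k<K. a k) * (\<Sum>k<K. u k x)"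
        using a(1) by (simp add: u_def power_divide less_imp_le)
      also have "\<dots> \<le> (\<Sum>k. a k) * (\<Sum>k. u k x)"
        using a x u0 by (intro mult_mono sum_le_suminf suminf_nonneg sum_nonneg) (auto simp: less_imp_le)
      finally show ?thesis .
    qed
    then show "\<exists>N. \<forall>K\<ge>N. (\<Sum>k<K. g k x)\<^sup>2 \<le> (\<Sum>k. a k) * (\<Sum>k. u k x)" by blast
  qed
  have A0: "(\<Sum>k. a k) \<ge> 0" using a by (intro suminf_nonneg) (auto simp: less_imp_le)
  have "(\<integral>\<^sup>+x. ennreal ((\<Sum>k. g k x)\<^sup>2) \<partial>M) \<le>
      (\<integral>\<^sup>+x. ennreal (\<Sum>k. a k) * (\<Sum>k. ennreal (u k x)) \<partial>M)"
  proof (rule nn_integral_mono_AE)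
    show "AE x in M. ennreal ((\<Sum>k. g k x)\<^sup>2) \<le> ennreal (\<Sum>k. a k) * (\<Sum>k. ennreal (u k x))"
      using su
    proof eventually_elim
      case (elim x)
      have "ennreal ((\<Sum>k. g k x)\<^sup>2) \<le> ennreal ((\<Sum>k. a k) * (\<Sum>k. u k x))"
        by (rule ennreal_leI[OF sq[OF elim]])
      also have "\<dots> = ennreal (\<Sum>k. a k) * (\<Sum>k. ennreal (u k x))"
        using elim u0 A0 by (simp add: suminf_ennreal2 ennreal_mult' suminf_nonneg)
      finally show ?case .
    qed
  qed
  also have "\<dots> = ennreal (\<Sum>k. a k) * (\<integral>\<^sup>+x. (\<Sum>k. ennreal (u k x)) \<partial>M)"
    by (rule nn_integral_cmult) measurable
  also have "\<dots> \<le> ennreal (\<Sum>k. a k) * ennreal (W * (\<Sum>k. a k))"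
    by (rule mult_left_mono[OF U]) simp
  also have "\<dots> = ennreal (W * (\<Sum>k. a k)\<^sup>2)"
    using A0 W by (simp add: power2_eq_square ac_simps flip: ennreal_mult)
  finally show "(\<integral>\<^sup>+x. ennreal ((\<Sum>k. g k x)\<^sup>2) \<partial>M) \<le> ennreal (W * (\<Sum>k. a k)\<^sup>2)" .
qed

lemma square_integrable_bounded:
  assumes "finite_measure M" "u \<in> borel_measurable M" "\<And>x. x \<in> space M \<Longrightarrow> \<bar>u x\<bar> \<le> B"
  shows "square_integrable M u"
proof -
  interpret finite_measure M by fact
  have "integrable M (\<lambda>x. (u x)\<^sup>2)"
  proof (rule integrable_const_bound[of _ "B\<^sup>2"])
    show "AE x in M. norm ((u x)\<^sup>2) \<le> B\<^sup>2"
      using power_mono[OF assms(3), of _ 2] by (intro AE_I2) simp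
  qed (use assms(2) in measurable)
  with assms(2) show ?thesis by (simp add: square_integrable_def)
qed

lemma square_integrable_diff:
  assumes "square_integrable M u" "square_integrable M v"
  shows "square_integrable M (\<lambda>x. u x - v x)"
proof -
  have uv [measurable]: "u \<in> borel_measurable M" "v \<in> borel_measurable M"
    using assms by (auto simp: square_integrable_def)
  have le: "(x - y)\<^sup>2 \<le> 2 * x\<^sup>2 + 2 * y\<^sup>2" for x y :: real
    using zero_le_power2[of "x + y"] by (simp add: power2_eq_square algebra_simps)
  have "integrable M (\<lambda>x. (u x - v x)\<^sup>2)"
    by (rule Bochner_Integration.integrable_bound[of _ "\<lambda>x. 2 * (u x)\<^sup>2 + 2 * (v x)\<^sup>2"])
      (use assms le in \<open>auto simp: square_integrable_def intro!: AE_I2\<close>)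
  then show ?thesis by (simp add: square_integrable_def)
qed

text \<open>The bound is assumed for the nonnegative integral, because \<open>L2_norm_on\<close> is
  0 when the square is not integrable; finiteness has to be secured together with the norm.\<close>

lemma L2_norm_on_le:
  assumes u: "u \<in> borel_measurable M" and le: "(\<integral>\<^sup>+x. ennreal ((u x)\<^sup>2) \<partial>M) \<le> ennreal (b\<^sup>2)" and b: "b \<ge> 0"
  shows "square_integrable M u" "L2_norm_on M u \<le> b"
proof -
  have "integrable M (\<lambda>x. (u x)\<^sup>2)"
    using u le by (intro integrableI_bounded) (auto simp: le_less_trans)
  then show "square_integrable M u" using u by (simp add: square_integrable_def)
  have "(\<integral>x. (u x)\<^sup>2 \<partial>M) = enn2real (\<integral>\<^sup>+x. ennreal ((u x)\<^sup>2) \<partial>M)"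
    using u by (intro integral_eq_nn_integral) auto
  also have "\<dots> \<le> b\<^sup>2"
    using enn2real_mono[OF le] by simp
  finally show "L2_norm_on M u \<le> b"
    using b by (simp add: L2_norm_on_def real_le_lsqrt)
qed

text \<open>The parallelogram identity gives \<open>(x - y)\<^sup>2 \<le> 2 * (z - x)\<^sup>2 + 2 *
  (z - y)\<^sup>2\<close> pointwise, which takes the place of the triangle inequality for the
  norm.\<close>

lemma L2_tendsto_unique_AE:
  assumes v: "L2_tendsto M u v" and w: "L2_tendsto M u w"
  shows "AE x in M. v x = w x"
proof -
  have sq: "square_integrable M (\<lambda>x. u K x - v x)" "square_integrable M (\<lambda>x. u K x - w x)"
    "square_integrable M (\<lambda>x. v x - w x)" for K
    using v w by (auto simp: L2_tendsto_def intro: square_integrable_diff)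
  have int: "integrable M (\<lambda>x. (v x - w x)\<^sup>2)"
    using sq(3) by (simp add: square_integrable_def)
  have "(\<integral>x. (v x - w x)\<^sup>2 \<partial>M) \<le> 0"
  proof (rule LIMSEQ_le_const)
    have "(\<lambda>K. 2 * (L2_norm_on M (\<lambda>x. u K x - v x))\<^sup>2 + 2 * (L2_norm_on M (\<lambda>x. u K x - w x))\<^sup>2)
        \<longlonglongrightarrow> 2 * 0\<^sup>2 + 2 * 0\<^sup>2"
      using v w unfolding L2_tendsto_def by (intro tendsto_intros) auto
    then show "(\<lambda>K. 2 * (L2_norm_on M (\<lambda>x. u K x - v x))\<^sup>2 + 2 * (L2_norm_on M (\<lambda>x. u K x - w x))\<^sup>2)
        \<longlonglongrightarrow> 0" by simp
    have "(\<integral>x. (v x - w x)\<^sup>2 \<partial>M) \<le>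
        2 * (L2_norm_on M (\<lambda>x. u K x - v x))\<^sup>2 + 2 * (L2_norm_on M (\<lambda>x. u K x - w x))\<^sup>2" for K
    proof -
      have "(x - y)\<^sup>2 \<le> 2 * (z - x)\<^sup>2 + 2 * (z - y)\<^sup>2" for x y z :: real
        using zero_le_power2[of "2 * z - x - y"] by (simp add: power2_eq_square algebra_simps)
      then have "(\<integral>x. (v x - w x)\<^sup>2 \<partial>M) \<le> (\<integral>x. 2 * (u K x - v x)\<^sup>2 + 2 * (u K x - w x)\<^sup>2 \<partial>M)"
        using sq by (intro integral_mono) (auto simp: square_integrable_def)
      also have "\<dots> = 2 * (\<integral>x. (u K x - v x)\<^sup>2 \<partial>M) + 2 * (\<integral>x. (u K x - w x)\<^sup>2 \<partial>M)"
        using sq(1,2)[of K] by (simp add: square_integrable_def)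
      finally show ?thesis by (simp add: L2_norm_on_def)
    qed
    then show "\<exists>N. \<forall>K\<ge>N. (\<integral>x. (v x - w x)\<^sup>2 \<partial>M) \<le>
        2 * (L2_norm_on M (\<lambda>x. u K x - v x))\<^sup>2 + 2 * (L2_norm_on M (\<lambda>x. u K x - w x))\<^sup>2" by blast
  qed
  then have "(\<integral>x. (v x - w x)\<^sup>2 \<partial>M) = 0" by (simp add: antisym)
  then have "AE x in M. (v x - w x)\<^sup>2 = 0"
    using int by (subst (asm) integral_nonneg_eq_0_iff_AE) auto
  then show ?thesis by eventually_elim simp
qed

text \<open>Here \<open>F\<close> stands for the expansion of \<open>f\<close> and \<open>H\<close>
  for that of the interpolant. The distance of \<open>H K\<close> from its limit is the uniform
  error \<open>F K - f\<close> plus the tail of the series of the \<open>g k\<close>, and both are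
  controlled.\<close>

lemma L2_tendsto_uniform_limit_minus_series:
  fixes f :: "'a \<Rightarrow> real" and F H g :: "nat \<Rightarrow> 'a \<Rightarrow> real"
  assumes M: "finite_measure M"
    and f: "square_integrable M f" and H: "\<And>K. square_integrable M (H K)"
    and F: "uniform_limit (space M) F f sequentially"
    and FH: "\<And>K x. x \<in> space M \<Longrightarrow> F K x - H K x = (\<Sum>k<K. g k x)"
    and g [measurable]: "\<And>k. g k \<in> borel_measurable M"
    and a: "\<And>k. a k > 0" "summable a" and W: "W \<ge> 0"
    and le: "\<And>k. (\<integral>\<^sup>+x. ennreal ((g k x)\<^sup>2) \<partial>M) \<le> ennreal (W * (a k)\<^sup>2)"
  shows "L2_tendsto M H (\<lambda>x. f x - (\<Sum>k. g k x))"
    and "L2_norm_on M (\<lambda>x. \<Sum>k. g k x) \<le> sqrt W * (\<Sum>k. a k)"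
proof -
  interpret finite_measure M by fact
  let ?S = "\<lambda>x. \<Sum>k. g k x" and ?\<mu> = "measure M (space M)"
  have [measurable]: "f \<in> borel_measurable M" "\<And>K. H K \<in> borel_measurable M"
    using f H by (auto simp: square_integrable_def)
  have A0: "(\<Sum>k. a k) \<ge> 0" using a by (intro suminf_nonneg) (auto simp: less_imp_le)
  have S: "?S \<in> borel_measurable M" by measurable
  have "(\<integral>\<^sup>+x. ennreal ((?S x)\<^sup>2) \<partial>M) \<le> ennreal ((sqrt W * (\<Sum>k. a k))\<^sup>2)"
    using L2_weighted_series(2)[of g M a W] g a W le by (simp add: power_mult_distrib)
  from L2_norm_on_le[OF S this] A0 W
  have sqS: "square_integrable M ?S" and nS: "L2_norm_on M ?S \<le> sqrt W * (\<Sum>k. a k)" by auto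
  show "L2_norm_on M ?S \<le> sqrt W * (\<Sum>k. a k)" by (rule nS)
  have h: "square_integrable M (\<lambda>x. f x - ?S x)" by (intro square_integrable_diff f sqS)
  \<comment> \<open>The weighted estimate applied to the shifted series bounds the norm of the tail
    by \<open>sqrt W * T K\<close>.\<close>
  define T where "T K = (\<Sum>k. a (k + K))" for K
  have T: "T \<longlonglongrightarrow> 0"
  proof -
    have "(\<lambda>K. (\<Sum>k. a k) - (\<Sum>k<K. a k)) \<longlonglongrightarrow> (\<Sum>k. a k) - (\<Sum>k. a k)"
      by (intro tendsto_intros summable_LIMSEQ a)
    then show ?thesis using a by (simp add: T_def[abs_def] suminf_minus_initial_segment)
  qed
  have T0: "T K \<ge> 0" for K
    unfolding T_def using a by (intro suminf_nonneg) (auto simp: less_imp_le summable_iff_shift)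
  have summ: "AE x in M. summable (\<lambda>k. g k x)"
    using L2_weighted_series(1)[of g M a W] g a W le by simp
  have tail: "(\<integral>\<^sup>+x. ennreal ((\<Sum>k. g (k + K) x)\<^sup>2) \<partial>M) \<le> ennreal (W * (T K)\<^sup>2)" for K
    unfolding T_def
    by (rule L2_weighted_series(2)) (use a W le in \<open>auto simp: summable_iff_shift\<close>)
  \<comment> \<open>One \<open>e\<close> serves for both errors. Since
    \<open>(x + y)\<^sup>2 \<le> 2 * x\<^sup>2 + 2 * y\<^sup>2\<close>, the uniform error
    contributes \<open>2 * ?\<mu>\<close> and the tail \<open>2 * W\<close>, each times
    \<open>e\<^sup>2\<close>.\<close>
  have bound: "L2_norm_on M (\<lambda>x. H K x - (f x - ?S x)) \<le> e * sqrt (2 * ?\<mu> + 2 * W)"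
    if e: "e > 0" "T K \<le> e" "\<And>x. x \<in> space M \<Longrightarrow> \<bar>F K x - f x\<bar> \<le> e" for e K
  proof (rule L2_norm_on_le(2))
    have "(\<integral>\<^sup>+x. ennreal ((H K x - (f x - ?S x))\<^sup>2) \<partial>M) \<le>
        (\<integral>\<^sup>+x. ennreal (2 * e\<^sup>2) + 2 * ennreal ((\<Sum>k. g (k + K) x)\<^sup>2) \<partial>M)"
    proof (rule nn_integral_mono_AE)
      show "AE x in M. ennreal ((H K x - (f x - ?S x))\<^sup>2) \<le>
          ennreal (2 * e\<^sup>2) + 2 * ennreal ((\<Sum>k. g (k + K) x)\<^sup>2)"
        using summ AE_space
      proof eventually_elim
        case (elim x)
        have "H K x - (f x - ?S x) = (F K x - f x) + (\<Sum>k. g (k + K) x)"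
          using FH[of x K] suminf_split_initial_segment[OF elim(1), of K] elim(2) by simp
        then have "(H K x - (f x - ?S x))\<^sup>2 \<le> 2 * (F K x - f x)\<^sup>2 + 2 * (\<Sum>k. g (k + K) x)\<^sup>2"
          using zero_le_power2[of "(F K x - f x) - (\<Sum>k. g (k + K) x)"]
          by (simp add: power2_eq_square algebra_simps)
        also have "\<dots> \<le> 2 * e\<^sup>2 + 2 * (\<Sum>k. g (k + K) x)\<^sup>2"
          using power_mono[OF e(3)[OF elim(2)], of 2] by simp
        finally have "ennreal ((H K x - (f x - ?S x))\<^sup>2) \<le> ennreal (2 * e\<^sup>2 + 2 * (\<Sum>k. g (k + K) x)\<^sup>2)"
          by (rule ennreal_leI)
        then show ?case by (simp add: ennreal_mult)
      qed
    qed
    also have "\<dots> = ennreal (2 * e\<^sup>2) * emeasure M (space M) +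
        2 * (\<integral>\<^sup>+x. ennreal ((\<Sum>k. g (k + K) x)\<^sup>2) \<partial>M)"
      by (simp add: nn_integral_add nn_integral_cmult)
    also have "\<dots> \<le> ennreal (2 * e\<^sup>2) * emeasure M (space M) + 2 * ennreal (W * e\<^sup>2)"
      using W e T0 power_mono[OF e(2) T0, of 2]
      by (intro add_mono mult_left_mono order_refl order_trans[OF tail] ennreal_leI) auto
    also have "\<dots> = ennreal ((e * sqrt (2 * ?\<mu> + 2 * W))\<^sup>2)"
    proof -
      have "ennreal (2 * e\<^sup>2) * emeasure M (space M) + 2 * ennreal (W * e\<^sup>2) =
          ennreal (2 * e\<^sup>2 * ?\<mu> + 2 * (W * e\<^sup>2))"
        using W by (simp add: emeasure_eq_measure ennreal_mult ennreal_plus)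
      also have "2 * e\<^sup>2 * ?\<mu> + 2 * (W * e\<^sup>2) = (e * sqrt (2 * ?\<mu> + 2 * W))\<^sup>2"
        using W by (simp add: power_mult_distrib algebra_simps)
      finally show ?thesis .
    qed
    finally show "(\<integral>\<^sup>+x. ennreal ((H K x - (f x - ?S x))\<^sup>2) \<partial>M) \<le>
        ennreal ((e * sqrt (2 * ?\<mu> + 2 * W))\<^sup>2)" .
  qed (use e W in auto)
  have "(\<lambda>K. L2_norm_on M (\<lambda>x. H K x - (f x - ?S x))) \<longlonglongrightarrow> 0"
  proof (rule LIMSEQ_I)
    fix \<epsilon> :: real assume \<epsilon>: "\<epsilon> > 0"
    define c where "c = sqrt (2 * ?\<mu> + 2 * W)"
    have c: "c \<ge> 0" using W by (simp add: c_def)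
    \<comment> \<open>\<open>c\<close> may be 0; the denominator \<open>c + 1\<close> is positive in
      any case.\<close>
    define e where "e = \<epsilon> / (c + 1)"
    have e: "e > 0" "e * c < \<epsilon>" using \<epsilon> c by (auto simp: e_def field_simps)
    have "eventually (\<lambda>K. T K < e) sequentially"
      using T e(1) by (rule order_tendstoD)
    moreover have "eventually (\<lambda>K. \<forall>x\<in>space M. dist (F K x) (f x) < e) sequentially"
      using F e(1) by (rule uniform_limitD)
    ultimately have "eventually (\<lambda>K. norm (L2_norm_on M (\<lambda>x. H K x - (f x - ?S x)) - 0) < \<epsilon>) sequentially"
    proof eventually_elim
      case (elim K)
      have "L2_norm_on M (\<lambda>x. H K x - (f x - ?S x)) \<le> e * c"
        unfolding c_def by (rule bound) (use e elim in \<open>auto simp: dist_real_def less_imp_le\<close>)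
      moreover have "L2_norm_on M (\<lambda>x. H K x - (f x - ?S x)) \<ge> 0" by (simp add: L2_norm_on_def)
      ultimately show ?case using e by simp
    qed
    then show "\<exists>no. \<forall>K\<ge>no. norm (L2_norm_on M (\<lambda>x. H K x - (f x - ?S x)) - 0) < \<epsilon>"
      by (simp add: eventually_sequentially)
  qed
  then show "L2_tendsto M H (\<lambda>x. f x - ?S x)"
    using H h by (simp add: L2_tendsto_def)
qed

section \<open>Dimension of the space of spherical harmonics\<close>

definition monomial_fun :: "('n \<Rightarrow> nat) \<Rightarrow> real^'n::finite \<Rightarrow> real" where
  "monomial_fun \<alpha> x = (\<Prod>i\<in>UNIV. x $ i ^ \<alpha> i)"

text \<open>The homogeneous polynomials of degree \<open>k\<close>, given by generators: products
  are then handled by span induction, and the number of generators bounds the dimension.\<close>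

definition homogeneous_span :: "nat \<Rightarrow> (real^'n::finite \<Rightarrow> real) set" where
  "homogeneous_span k = fun_space.span (monomial_fun ` {\<alpha>. sum \<alpha> UNIV = k})"

lemma homogeneous_span_mult:
  fixes p q :: "real^'n::finite \<Rightarrow> real"
  assumes p: "p \<in> homogeneous_span j" and q: "q \<in> homogeneous_span k"
  shows "(\<lambda>x. p x * q x) \<in> homogeneous_span (j + k)"
proof -
  have 1: "(\<lambda>x. monomial_fun \<alpha> x * q x) \<in> homogeneous_span (j + k)" if "sum \<alpha> UNIV = j" for \<alpha> :: "'n \<Rightarrow> nat"
    using q unfolding homogeneous_span_def
  proof (induction rule: fun_space.span_induct_alt)
    case base
    then show ?case by (simp add: fun_space.span_zero flip: zero_fun_def)
  next
    case (step c m y)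
    then obtain \<beta> where \<beta>: "m = monomial_fun \<beta>" "sum \<beta> UNIV = k" by auto
    have "(\<lambda>x. monomial_fun \<alpha> x * monomial_fun \<beta> x) = monomial_fun (\<lambda>i. \<alpha> i + \<beta> i)"
      by (simp add: monomial_fun_def fun_eq_iff power_add prod.distrib)
    then have "(\<lambda>x. monomial_fun \<alpha> x * m x) \<in> fun_space.span (monomial_fun ` {\<alpha>. sum \<alpha> UNIV = j + k})"
      using \<beta> that by (auto intro!: fun_space.span_base imageI simp: sum.distrib)
    from fun_space.span_add[OF fun_space.span_scale[OF this, of c] step.IH]
    show ?case by (simp add: plus_fun_def algebra_simps)
  qed
  show ?thesis
    using p unfolding homogeneous_span_def[of j]
  proof (induction rule: fun_space.span_induct_alt)
    case base
    then show ?case by (simp add: homogeneous_span_def fun_space.span_zero flip: zero_fun_def)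
  next
    case (step c m y)
    then have "(\<lambda>x. m x * q x) \<in> homogeneous_span (j + k)" using 1 by auto
    from fun_space.span_add[OF fun_space.span_scale[OF this[unfolded homogeneous_span_def], of c]
        step.IH[unfolded homogeneous_span_def]]
    show ?case by (simp add: homogeneous_span_def plus_fun_def algebra_simps)
  qed
qed

lemma homogeneous_span_sum:
  assumes "\<And>i. i \<in> A \<Longrightarrow> p i \<in> homogeneous_span k"
  shows "(\<lambda>x. \<Sum>i\<in>A. p i x) \<in> homogeneous_span k"
proof -
  have "(\<Sum>i\<in>A. p i) \<in> homogeneous_span k"
    using assms unfolding homogeneous_span_def by (intro fun_space.span_sum) auto
  moreover have "(\<Sum>i\<in>A. p i) = (\<lambda>x. \<Sum>i\<in>A. p i x)"
    by (induction A rule: infinite_finite_induct) (auto simp: fun_eq_iff)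
  ultimately show ?thesis by simp
qed

lemma homogeneous_span_scale_arg:
  assumes "p \<in> homogeneous_span k"
  shows "p (c *\<^sub>R x) = c ^ k * p x"
  using assms unfolding homogeneous_span_def
proof (induction rule: fun_space.span_induct_alt)
  case (step a m y)
  then obtain \<alpha> where "m = monomial_fun \<alpha>" "sum \<alpha> UNIV = k" by auto
  then have "m (c *\<^sub>R x) = c ^ k * m x"
    by (auto simp: monomial_fun_def power_mult_distrib prod.distrib simp flip: power_sum)
  then show ?case using step.IH by (simp add: algebra_simps)
qed simp

text \<open>Structural induction over polynomial functions. The parts above \<open>d\<close> are
  required to vanish so that the parts of a sum can be padded to a common length and those of a
  product form a Cauchy product.\<close>

lemma real_polynomial_function_homogeneous_parts:
  fixes p :: "real^'n::finite \<Rightarrow> real"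
  assumes "real_polynomial_function p"
  shows "\<exists>P d. (\<forall>j. P j \<in> homogeneous_span j) \<and> (\<forall>j>d. P j = 0) \<and> (\<forall>x. p x = (\<Sum>j\<le>d. P j x))"
  using assms
proof (induction rule: real_polynomial_function.induct)
  case (linear f)
  have "f x = (\<Sum>i\<in>UNIV. f (axis i 1) * x $ i)" for x
  proof -
    have "f x = f (\<Sum>i\<in>UNIV. x $ i *\<^sub>R axis i 1)"
      by (metis basis_expansion scalar_mult_eq_scaleR)
    also have "\<dots> = (\<Sum>i\<in>UNIV. f (axis i 1) * x $ i)"
      using linear by (simp add: linear_sum linear_cmul bounded_linear.linear mult.commute)
    finally show ?thesis .
  qed
  moreover have "(\<lambda>x. \<Sum>i\<in>UNIV. f (axis i 1) * x $ i) \<in> homogeneous_span 1"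
  proof (rule homogeneous_span_sum)
    fix i :: 'n
    have "(\<lambda>x. x $ i) = monomial_fun (\<lambda>j. if j = i then 1 else 0)"
    proof
      fix x :: "real^'n"
      have "(\<Prod>j\<in>UNIV. x $ j ^ (if j = i then 1 else 0)) = (\<Prod>j\<in>UNIV. if j = i then x $ j else 1)"
        by (intro prod.cong) auto
      then show "x $ i = monomial_fun (\<lambda>j. if j = i then 1 else 0) x"
        by (simp add: monomial_fun_def)
    qed
    then have "(\<lambda>x. x $ i) \<in> fun_space.span (monomial_fun ` {\<alpha>::'n \<Rightarrow> nat. sum \<alpha> UNIV = 1})"
      by (auto intro!: fun_space.span_base)
    from fun_space.span_scale[OF this]
    show "(\<lambda>x. f (axis i 1) * x $ i) \<in> homogeneous_span 1"
      by (simp add: homogeneous_span_def)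
  qed
  ultimately have f: "f \<in> homogeneous_span 1" by (metis (no_types, lifting) ext)
  show ?case
  proof (intro exI[of _ "\<lambda>j. if j = 1 then f else 0"] exI[of _ 1] conjI allI impI)
    show "(if j = 1 then f else 0) \<in> homogeneous_span j" for j
      using f by (auto simp: homogeneous_span_def fun_space.span_zero)
  qed auto
next
  case (const c)
  have "(\<lambda>_. 1) = monomial_fun (\<lambda>_::'n. 0)"
    by (simp add: monomial_fun_def fun_eq_iff)
  then have "(\<lambda>_. 1) \<in> fun_space.span (monomial_fun ` {\<alpha>::'n \<Rightarrow> nat. sum \<alpha> UNIV = 0})"
    by (auto intro!: fun_space.span_base)
  from fun_space.span_scale[OF this, of c] have "(\<lambda>_::real^'n. c) \<in> homogeneous_span 0"
    by (simp add: homogeneous_span_def)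
  then show ?case
    by (intro exI[of _ "\<lambda>j. if j = 0 then \<lambda>_. c else 0"] exI[of _ 0])
      (auto simp: homogeneous_span_def fun_space.span_zero)
next
  case (add f g)
  then obtain P d Q e where P: "\<And>j. P j \<in> homogeneous_span j" "\<And>j. j > d \<Longrightarrow> P j = 0" "\<And>x. f x = (\<Sum>j\<le>d. P j x)"
    and Q: "\<And>j. Q j \<in> homogeneous_span j" "\<And>j. j > e \<Longrightarrow> Q j = 0" "\<And>x. g x = (\<Sum>j\<le>e. Q j x)"
    by metis
  have f: "f x = (\<Sum>j\<le>max d e. P j x)" for x
    unfolding P(3) using P(2) by (intro sum.mono_neutral_left) auto
  have g: "g x = (\<Sum>j\<le>max d e. Q j x)" for x
    unfolding Q(3) using Q(2) by (intro sum.mono_neutral_left) auto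
  show ?case
  proof (intro exI[of _ "\<lambda>j. P j + Q j"] exI[of _ "max d e"] conjI allI impI)
    show "P j + Q j \<in> homogeneous_span j" for j
      using P(1)[of j] Q(1)[of j] unfolding homogeneous_span_def by (rule fun_space.span_add)
  qed (auto simp: f g P Q sum.distrib)
next
  case (mult f g)
  then obtain P d Q e where P: "\<And>j. P j \<in> homogeneous_span j" "\<And>j. j > d \<Longrightarrow> P j = 0" "\<And>x. f x = (\<Sum>j\<le>d. P j x)"
    and Q: "\<And>j. Q j \<in> homogeneous_span j" "\<And>j. j > e \<Longrightarrow> Q j = 0" "\<And>x. g x = (\<Sum>j\<le>e. Q j x)"
    by metis
  define S where "S j = (\<lambda>x. \<Sum>i\<le>j. P i x * Q (j - i) x)" for j
  show ?case
  proof (intro exI[of _ S] exI[of _ "d + e"] conjI allI impI)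
    show "S j \<in> homogeneous_span j" for j
      unfolding S_def using homogeneous_span_mult[OF P(1) Q(1)]
      by (intro homogeneous_span_sum) (metis atMost_iff le_add_diff_inverse)
    show "S j = 0" if "j > d + e" for j
    proof -
      have "P i x * Q (j - i) x = 0" if "i \<le> j" for i x
        using P(2)[of i] Q(2)[of "j - i"] \<open>j > d + e\<close> that by (cases "i > d") auto
      then show ?thesis by (auto simp: S_def fun_eq_iff intro!: sum.neutral)
    qed
    \<comment> \<open>The values \<open>P j x\<close> and \<open>Q j x\<close> are treated as
      coefficients of two univariate polynomials, whose product is evaluated at 1.\<close>
    show "f x * g x = (\<Sum>j\<le>d + e. S j x)" for x
      unfolding P(3) Q(3) S_def
      using polynomial_product[of d "\<lambda>j. P j x" e "\<lambda>j. Q j x" 1] by (simp add: P Q)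
  qed
qed

text \<open>For fixed \<open>x\<close>, the value \<open>p (c *\<^sub>R x)\<close> is a polynomial
  in \<open>c\<close> in two ways: with coefficients \<open>P j x\<close>, and as the monomial
  \<open>p x * c ^ k\<close>. Comparing the coefficients of \<open>c ^ k\<close> identifies
  \<open>p\<close> with its part \<open>P k\<close>.\<close>

lemma homogeneous_polynomial_in_span:
  fixes p :: "real^'n::finite \<Rightarrow> real"
  assumes "real_polynomial_function p" and hom: "\<And>c x. p (c *\<^sub>R x) = c ^ k * p x"
  shows "p \<in> homogeneous_span k"
proof -
  obtain P d where P: "\<And>j. P j \<in> homogeneous_span j" "\<And>j. j > d \<Longrightarrow> P j = 0" "\<And>x. p x = (\<Sum>j\<le>d. P j x)"
    using real_polynomial_function_homogeneous_parts[OF assms(1)] by metis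
  have "p x = P k x" for x
  proof -
    define s where "s = (\<Sum>j\<le>d. monom (P j x) j)"
    have "poly s c = poly (monom (p x) k) c" for c
      using hom[of c x] homogeneous_span_scale_arg[OF P(1), of _ c x]
      by (simp add: P(3) s_def poly_sum poly_monom mult.commute)
    then have "s = monom (p x) k" by (simp add: fun_eq_iff flip: poly_eq_poly_eq_iff)
    then have "coeff s k = p x" by simp
    moreover have "coeff s k = P k x"
      using P(2)[of k] by (auto simp: s_def coeff_sum not_less)
    ultimately show ?thesis by simp
  qed
  then have "p = P k" by auto
  then show ?thesis using P(1) by simp
qed

text \<open>Any polynomial growth in \<open>k\<close> is harmless against a geometric sequence, so
  the monomials are counted crudely: each exponent is one of \<open>k + 1\<close> numbers.\<close>

lemma harmonic_dim_le:
  "harmonic_dim TYPE('n::finite) k \<le> (k + 1) ^ CARD('n)"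
proof -
  let ?A = "{\<alpha>::'n \<Rightarrow> nat. sum \<alpha> UNIV = k}" and ?B = "PiE (UNIV::'n set) (\<lambda>_. {..k})"
  have AB: "?A \<subseteq> ?B"
    by (auto simp: PiE_def intro: member_le_sum)
  have B: "finite ?B" "card ?B = (k + 1) ^ CARD('n)"
    by (auto intro!: finite_PiE simp: card_PiE)
  have "harmonic_dim TYPE('n) k \<le> card (monomial_fun ` ?A)"
    unfolding harmonic_dim_def
  proof (rule fun_space.dim_le_card)
    show "harmonic_homogeneous k \<subseteq> fun_space.span (monomial_fun ` ?A)"
      using homogeneous_polynomial_in_span by (auto simp: harmonic_homogeneous_def homogeneous_span_def)
  qed (use AB B finite_subset in blast)
  also have "\<dots> \<le> card ?A" by (rule card_image_le) (use AB B finite_subset in blast)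
  also have "\<dots> \<le> (k + 1) ^ CARD('n)" using card_mono[OF B(1) AB] B(2) by simp
  finally show ?thesis .
qed

section \<open>Size of the interpolation errors\<close>

lemma smooth_within_has_derivative:
  assumes "smooth_within S c" "t \<in> S"
  shows "(nderiv_within m S c has_real_derivative nderiv_within (Suc m) S c t) (at t within S)"
proof -
  have "nderiv_within m S c differentiable (at t within S)"
    using assms by (auto simp: smooth_within_def differentiable_on_def)
  then show ?thesis
    by (simp add: nderiv_within_def has_real_derivative_iff_has_vector_derivative vector_derivative_works[symmetric])
qed

lemma continuous_on_nderiv_within: "smooth_within S c \<Longrightarrow> continuous_on S (nderiv_within m S c)"
  by (simp add: smooth_within_def differentiable_imp_continuous_on)

text \<open>\<open>x\<close> and all nodes lie in \<open>{0..b}\<close>, so each factor of the node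
  product is at most \<open>b\<close>. With \<open>b = R\<^sup>2\<close> and \<open>N\<close> nodes
  this is the source of \<open>R ^ (2 * N)\<close>.\<close>

lemma interpolation_error_smooth_within:
  assumes c: "smooth_within {0..b} c" and A: "finite A" "A \<subseteq> {0..b}" "A \<noteq> {}"
    and p: "degree p < card A" "\<And>z. z \<in> A \<Longrightarrow> poly p z = c z"
    and B: "\<And>t. t \<in> {0..b} \<Longrightarrow> \<bar>1 / fact (card A) * nderiv_within (card A) {0..b} c t\<bar> \<le> B"
    and x: "x \<in> {0..b}"
  shows "\<bar>c x - poly p x\<bar> \<le> B * b ^ card A"
proof -
  have "\<exists>t\<in>{0..b}. nderiv_within 0 {0..b} c x - poly p x =
      nderiv_within (card A) {0..b} c t / fact (card A) * (\<Prod>z\<in>A. x - z)"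
    by (rule interpolation_error)
      (use A p x smooth_within_has_derivative[OF c] in \<open>auto simp: nderiv_within_def\<close>)
  then obtain t where t: "t \<in> {0..b}" "c x - poly p x =
      1 / fact (card A) * nderiv_within (card A) {0..b} c t * (\<Prod>z\<in>A. x - z)"
    by (auto simp: nderiv_within_def)
  have "\<bar>\<Prod>z\<in>A. x - z\<bar> \<le> (\<Prod>z\<in>A. b)"
    unfolding abs_prod using A x by (intro prod_mono) fastforce
  moreover have "B \<ge> 0" using B[OF t(1)] by linarith
  ultimately show ?thesis
    using B[OF t(1)] unfolding t(2) abs_mult[of _ "prod _ _"]
    by (intro mult_mono) auto
qed

text \<open>Interpolation takes place in the variable \<open>t = r\<^sup>2\<close>. Squaring is
  injective on nonnegative radii, so distinct knots remain distinct nodes.\<close>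

lemma square_knots:
  assumes "admissible_knots TYPE('n::finite) R N \<rho>" "l \<in> {1..harmonic_dim TYPE('n) k}"
  defines "A \<equiv> (\<lambda>j. (\<rho> k l j)\<^sup>2) ` {1..N}"
  shows "finite A" "A \<subseteq> {0..R\<^sup>2}" "card A = N"
proof -
  have \<rho>: "0 \<le> \<rho> k l j" "\<rho> k l j \<le> R" if "j \<in> {1..N}" for j
    using assms(1,2) that by (auto simp: admissible_knots_def)
  have "inj_on (\<rho> k l) {1..N}"
    using assms(1,2) by (auto simp: admissible_knots_def intro!: strict_mono_on_imp_inj_on)
  then have "inj_on (\<lambda>j. (\<rho> k l j)\<^sup>2) {1..N}"
    using \<rho>(1) unfolding inj_on_def by (metis power2_eq_imp_eq)
  then show "card A = N" by (simp add: A_def card_image)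
  show "A \<subseteq> {0..R\<^sup>2}"
    using power_mono[OF \<rho>(2,1), of _ 2] by (auto simp: A_def)
qed (simp add: A_def)

text \<open>Ratio test: the quotient \<open>b k ^ n * x\<close> tends to \<open>x\<close>, hence is
  eventually below the midpoint \<open>(1 + x) / 2\<close> of \<open>x\<close> and 1.\<close>

lemma summable_power_times_geometric:
  fixes x :: real
  assumes "0 < x" "x < 1"
  shows "summable (\<lambda>k. (real k + 1) ^ n * x ^ k)"
proof -
  define b where "b k = 1 + inverse (real (Suc k))" for k
  have "b \<longlonglongrightarrow> 1 + 0"
    unfolding b_def by (intro tendsto_intros LIMSEQ_inverse_real_of_nat)
  then have "(\<lambda>k. b k ^ n * x) \<longlonglongrightarrow> 1 ^ n * x"
    by (intro tendsto_intros) simp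
  moreover have "1 ^ n * x < (1 + x) / 2" using assms by simp
  ultimately have "eventually (\<lambda>k. b k ^ n * x < (1 + x) / 2) sequentially"
    by (rule order_tendstoD(2))
  then obtain K where K: "\<And>k. k \<ge> K \<Longrightarrow> b k ^ n * x < (1 + x) / 2"
    unfolding eventually_sequentially by blast
  have b: "real (Suc k) + 1 = b k * (real k + 1)" for k
  proof -
    have "y + 1 = (1 + inverse y) * y" if "y \<noteq> 0" for y :: real
      using that by (simp add: distrib_right)
    from this[of "real (Suc k)"] show ?thesis by (simp add: b_def add.commute)
  qed
  show ?thesis
  proof (rule summable_ratio_test)
    show "norm ((real (Suc k) + 1) ^ n * x ^ Suc k) \<le> (1 + x) / 2 * norm ((real k + 1) ^ n * x ^ k)"
      if "k \<ge> K" for k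
    proof -
      have "norm ((real (Suc k) + 1) ^ n * x ^ Suc k) = (real (Suc k) + 1) ^ n * x ^ Suc k"
        using assms by simp
      also have "\<dots> = (b k ^ n * x) * ((real k + 1) ^ n * x ^ k)"
        unfolding b power_mult_distrib by simp
      also have "\<dots> \<le> (1 + x) / 2 * ((real k + 1) ^ n * x ^ k)"
        using less_imp_le[OF K[OF that]] assms by (intro mult_right_mono mult_nonneg_nonneg) auto
      finally show ?thesis using assms by simp
    qed
  qed (use assms in simp)
qed

lemma harmonic_seminorm_lessD:
  assumes R: "R > 0" and "ereal R * harmonic_seminorm TYPE('n::finite) R N c < 1"
  shows "\<exists>q>0. R * q < 1 \<and> (\<exists>k0. \<forall>k\<ge>k0. \<forall>l\<in>{1..harmonic_dim TYPE('n) k}. \<forall>t\<in>{0..R\<^sup>2}.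
           \<bar>1 / fact N * nderiv_within N {0..R\<^sup>2} (c k l) t\<bar> \<le> q ^ (k + N + 1))"
proof -
  let ?L = "harmonic_seminorm TYPE('n) R N c"
  have "?L < ereal (1 / R)"
    using assms by (cases ?L) (auto simp: field_simps one_ereal_def)
  \<comment> \<open>The maximum with 0 forces \<open>q > 0\<close>, whatever the value of
    \<open>?L\<close>.\<close>
  then have "max 0 ?L < ereal (1 / R)" using R by simp
  then obtain q' where q': "max 0 ?L < q'" "q' < ereal (1 / R)"
    using dense by blast
  then obtain q where q: "q' = ereal q" by (cases q') auto
  have q0: "q > 0" "R * q < 1" using q' R by (auto simp: q field_simps)
  have "?L < q" using q' q by simp
  from Limsup_lessD[OF this[unfolded harmonic_seminorm_def]]
  obtain k0 where k0: "\<And>k l. k \<ge> k0 \<Longrightarrow> l \<in> {1..harmonic_dim TYPE('n) k} \<Longrightarrow>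
      (SUP t\<in>{0..R\<^sup>2}. ereal (root (k + N + 1) \<bar>1 / fact N * nderiv_within N {0..R\<^sup>2} (c k l) t\<bar>)) < q"
    unfolding harmonic_index_filter_def eventually_inf_principal eventually_filtercomap_at_top_linorder
    by auto
  have "\<bar>1 / fact N * nderiv_within N {0..R\<^sup>2} (c k l) t\<bar> \<le> q ^ (k + N + 1)"
    if "k \<ge> k0" "l \<in> {1..harmonic_dim TYPE('n) k}" "t \<in> {0..R\<^sup>2}" for k l t
  proof -
    let ?y = "\<bar>1 / fact N * nderiv_within N {0..R\<^sup>2} (c k l) t\<bar>"
    have "ereal (root (k + N + 1) ?y) < ereal q"
      using SUP_upper[OF that(3)] k0[OF that(1,2)] by (rule le_less_trans)
    then have "root (k + N + 1) ?y ^ (k + N + 1) \<le> q ^ (k + N + 1)"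
      by (intro power_mono) auto
    then show ?thesis by (subst (asm) real_root_pow_pos2) auto
  qed
  then show ?thesis using q0 by blast
qed

text \<open>In the summable sequence, \<open>R ^ k\<close> accounts for the growth of a harmonic of
  degree \<open>k\<close> up to the outermost sphere, and the power of \<open>k + 1\<close> for the
  number of indices \<open>l\<close>. Eventually the terms are a constant times that power times
  \<open>(R * q) ^ k\<close>.\<close>

lemma interpolation_coefficients_bound:
  assumes N: "N \<ge> 1" and R: "R > 0"
    and c: "\<And>k l. l \<in> {1..harmonic_dim TYPE('n::finite) k} \<Longrightarrow> smooth_within {0..R\<^sup>2} (c k l)"
    and \<rho>: "admissible_knots TYPE('n) R N \<rho>"
    and L: "ereal R * harmonic_seminorm TYPE('n) R N c < 1"
    and p: "\<And>k l. l \<in> {1..harmonic_dim TYPE('n) k} \<Longrightarrow> degree (p k l) \<le> N - 1 \<and>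
           (\<forall>j\<in>{1..N}. poly (p k l) ((\<rho> k l j)\<^sup>2) = c k l ((\<rho> k l j)\<^sup>2))"
  obtains E where "\<And>k. E k > 0" "summable (\<lambda>k. (real k + 1) ^ CARD('n) * E k * R ^ k)"
    "\<And>k l t. l \<in> {1..harmonic_dim TYPE('n) k} \<Longrightarrow> t \<in> {0..R\<^sup>2} \<Longrightarrow> \<bar>c k l t - poly (p k l) t\<bar> \<le> E k"
proof -
  obtain q k0 where q: "q > 0" "R * q < 1" and
    qb: "\<And>k l t. k \<ge> k0 \<Longrightarrow> l \<in> {1..harmonic_dim TYPE('n) k} \<Longrightarrow> t \<in> {0..R\<^sup>2} \<Longrightarrow>
           \<bar>1 / fact N * nderiv_within N {0..R\<^sup>2} (c k l) t\<bar> \<le> q ^ (k + N + 1)"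
    using harmonic_seminorm_lessD[OF R L] by blast
  have "\<exists>B. \<forall>t\<in>{0..R\<^sup>2}. \<bar>c k l t - poly (p k l) t\<bar> \<le> B" if l: "l \<in> {1..harmonic_dim TYPE('n) k}" for k l
  proof -
    have "continuous_on {0..R\<^sup>2} (c k l)"
      using continuous_on_nderiv_within[OF c[OF l], of 0] by (simp add: nderiv_within_def)
    then have "continuous_on {0..R\<^sup>2} (\<lambda>t. c k l t - poly (p k l) t)"
      by (intro continuous_intros)
    from continuous_on_compact_bound[OF compact_Icc this] show ?thesis by (metis real_norm_def)
  qed
  then have "\<forall>k l. \<exists>B. l \<in> {1..harmonic_dim TYPE('n) k} \<longrightarrow> (\<forall>t\<in>{0..R\<^sup>2}. \<bar>c k l t - poly (p k l) t\<bar> \<le> B)"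
    by blast
  then obtain B where "\<forall>k l. l \<in> {1..harmonic_dim TYPE('n) k} \<longrightarrow> (\<forall>t\<in>{0..R\<^sup>2}. \<bar>c k l t - poly (p k l) t\<bar> \<le> B k l)"
    unfolding choice_iff by blast
  then have B: "\<bar>c k l t - poly (p k l) t\<bar> \<le> B k l"
    if "l \<in> {1..harmonic_dim TYPE('n) k}" "t \<in> {0..R\<^sup>2}" for k l t
    using that by blast
  \<comment> \<open>Below \<open>k0\<close> no estimate by \<open>q\<close> is available. Summing
    \<open>\<bar>B k l\<bar>\<close> gives one bound for all \<open>l\<close>, and the added 1 keeps
    \<open>E k\<close> positive, as the weights built from it will be divisors.\<close>
  define E where "E k = (if k < k0 then 1 + (\<Sum>l=1..harmonic_dim TYPE('n) k. \<bar>B k l\<bar>)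
      else q ^ (k + N + 1) * R ^ (2 * N))" for k
  show ?thesis
  proof
    show "E k > 0" for k
      using q R by (auto simp: E_def intro!: add_pos_nonneg sum_nonneg)
    have "summable (\<lambda>k. (q ^ (N + 1) * R ^ (2 * N)) * ((real k + 1) ^ CARD('n) * (R * q) ^ k))"
      using q R by (intro summable_mult summable_power_times_geometric) auto
    then show "summable (\<lambda>k. (real k + 1) ^ CARD('n) * E k * R ^ k)"
    proof (rule summable_cong[THEN iffD1, rotated])
      show "eventually (\<lambda>k. (q ^ (N + 1) * R ^ (2 * N)) * ((real k + 1) ^ CARD('n) * (R * q) ^ k) =
          (real k + 1) ^ CARD('n) * E k * R ^ k) sequentially"
        using eventually_ge_at_top[of k0]
        by eventually_elim (simp add: E_def power_add power_mult_distrib)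
    qed
    show "\<bar>c k l t - poly (p k l) t\<bar> \<le> E k"
      if l: "l \<in> {1..harmonic_dim TYPE('n) k}" and t: "t \<in> {0..R\<^sup>2}" for k l t
    proof (cases "k < k0")
      case True
      have "\<bar>B k l\<bar> \<le> (\<Sum>l=1..harmonic_dim TYPE('n) k. \<bar>B k l\<bar>)"
        using l by (intro member_le_sum) auto
      then show ?thesis using B[OF l t] True by (simp add: E_def)
    next
      case False
      define A where "A = (\<lambda>j. (\<rho> k l j)\<^sup>2) ` {1..N}"
      note A = square_knots[OF \<rho> l, folded A_def]
      have "\<bar>c k l t - poly (p k l) t\<bar> \<le> q ^ (k + N + 1) * (R\<^sup>2) ^ card A"
      proof (rule interpolation_error_smooth_within[OF c[OF l]])
        show "poly (p k l) z = c k l z" if "z \<in> A" for z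
          using p[OF l] that by (auto simp: A_def)
      qed (use A N p[OF l] qb[OF _ l] False t in \<open>auto\<close>)
      then show ?thesis using False A by (simp add: E_def power_mult)
    qed
  qed
qed

section \<open>Integration over spheres and balls\<close>

lemma finite_measure_sphere_measure: "finite_measure (sphere_measure :: (real^'n::finite) measure)"
proof
  have "emeasure (sphere_measure :: (real^'n) measure) (sphere 0 1) =
      of_nat CARD('n) * emeasure lborel {x \<in> ball 0 1 - {0}. sgn x \<in> sphere (0::real^'n) 1}"
    by (rule emeasure_sphere_measure) auto
  also have "\<dots> \<le> of_nat CARD('n) * emeasure lborel (ball (0::real^'n) 1)"
    by (intro mult_left_mono emeasure_mono) auto
  also have "\<dots> < \<infinity>"
    using emeasure_lborel_ball_finite[of "0::real^'n" 1]
    by (simp add: ennreal_mult_less_top of_nat_less_top)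
  finally show "emeasure sphere_measure (space (sphere_measure :: (real^'n) measure)) \<noteq> \<infinity>"
    by simp
qed

text \<open>Polar integration for functions of the direction alone. Dilation by \<open>R\<close>
  preserves directions and has Jacobian \<open>R ^ CARD('n)\<close>; the divisor
  \<open>CARD('n)\<close> undoes the factor in the cone definition of
  \<open>sphere_measure\<close>.\<close>

lemma nn_integral_ball_sgn:
  fixes u :: "real^'n::finite \<Rightarrow> ennreal"
  assumes u [measurable]: "u \<in> borel_measurable borel" and R: "R > 0"
  shows "(\<integral>\<^sup>+x. u (sgn x) * indicator (ball 0 R - {0}) x \<partial>lborel) =
           ennreal (R ^ CARD('n) / CARD('n)) * (\<integral>\<^sup>+\<theta>. u \<theta> \<partial>sphere_measure)"
proof -
  have sgn [measurable]: "(sgn :: real^'n \<Rightarrow> _) \<in> borel_measurable borel"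
    unfolding sgn_div_norm[abs_def] by measurable
  have B [measurable]: "ball 0 r - {0 :: real^'n} \<in> sets borel" for r by simp
  have m: "sgn \<in> measurable (scale_measure (of_nat CARD('n)) (restrict_space lborel (ball 0 1 - {0 :: real^'n})))
      (restrict_space borel (sphere 0 1))"
  proof -
    have "sgn \<in> measurable (restrict_space lborel (ball 0 1 - {0 :: real^'n})) (restrict_space borel (sphere 0 1))"
      using sgn by (intro measurable_restrict_space3) (auto simp: norm_sgn)
    then show ?thesis by (simp add: measurable_def space_scale_measure)
  qed
  have "(\<integral>\<^sup>+\<theta>. u \<theta> \<partial>sphere_measure) =
      (\<integral>\<^sup>+x. u (sgn x) \<partial>scale_measure (of_nat CARD('n)) (restrict_space lborel (ball 0 1 - {0 :: real^'n})))"
    unfolding sphere_measure_def by (rule nn_integral_distr[OF m]) (auto intro: measurable_restrict_space1)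
  also have "\<dots> = of_nat CARD('n) * (\<integral>\<^sup>+x. u (sgn x) \<partial>restrict_space lborel (ball 0 1 - {0}))"
    by (rule nn_integral_scale_measure) (auto intro!: measurable_restrict_space1)
  also have "(\<integral>\<^sup>+x. u (sgn x) \<partial>restrict_space lborel (ball 0 1 - {0})) =
      (\<integral>\<^sup>+x. u (sgn x) * indicator (ball 0 1 - {0}) x \<partial>lborel)"
    by (rule nn_integral_restrict_space) auto
  finally have 1: "(\<integral>\<^sup>+\<theta>. u \<theta> \<partial>sphere_measure) =
      of_nat CARD('n) * (\<integral>\<^sup>+x. u (sgn x) * indicator (ball 0 1 - {0}) x \<partial>lborel)" .
  have "(\<integral>\<^sup>+x. u (sgn x) * indicator (ball 0 R - {0}) x \<partial>lborel) =
      (\<integral>\<^sup>+x. u (sgn x) * indicator (ball 0 R - {0}) x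
         \<partial>density (distr lborel borel (\<lambda>x. 0 + R *\<^sub>R x)) (\<lambda>_. \<bar>R\<bar> ^ DIM(real^'n)))"
    using R by (subst lborel_affine[of R 0]) auto
  also have "\<dots> = (\<integral>\<^sup>+x. ennreal (R ^ CARD('n)) *
        (u (sgn (R *\<^sub>R x)) * indicator (ball 0 R - {0}) (R *\<^sub>R x)) \<partial>lborel)"
  proof -
    let ?v = "\<lambda>x::real^'n. u (sgn x) * indicator (ball 0 R - {0}) x"
    have v [measurable]: "?v \<in> borel_measurable borel" by measurable
    have "(\<lambda>x::real^'n. 0 + R *\<^sub>R x) \<in> measurable lborel borel" by measurable
    then show ?thesis
      using R by (simp add: nn_integral_density nn_integral_distr[of _ _ borel] nn_integral_cmult)
  qed
  also have "\<dots> = (\<integral>\<^sup>+x. ennreal (R ^ CARD('n)) *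
        (u (sgn x) * indicator (ball 0 1 - {0}) x) \<partial>lborel)"
    using R by (intro nn_integral_cong) (auto simp: sgn_scaleR split: split_indicator)
  also have "\<dots> = ennreal (R ^ CARD('n)) * (\<integral>\<^sup>+x. u (sgn x) * indicator (ball 0 1 - {0}) x \<partial>lborel)"
    by (rule nn_integral_cmult) measurable
  also have "\<dots> = ennreal (R ^ CARD('n) / CARD('n)) * (\<integral>\<^sup>+\<theta>. u \<theta> \<partial>sphere_measure)"
  proof -
    have "ennreal (R ^ CARD('n)) = ennreal (R ^ CARD('n) / CARD('n)) * of_nat CARD('n)"
      unfolding ennreal_of_nat_eq_real_of_nat using R by (subst ennreal_mult[symmetric]) auto
    then show ?thesis unfolding 1 by (simp add: mult.assoc)
  qed
  finally show ?thesis .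
qed

lemma orthonormal_harmonic_basisD:
  fixes Y :: "nat \<Rightarrow> nat \<Rightarrow> real^'n::finite \<Rightarrow> real"
  assumes Y: "orthonormal_harmonic_basis Y" and l: "l \<in> {1..harmonic_dim TYPE('n) k}"
  shows "continuous_on S (Y k l)" "Y k l (c *\<^sub>R x) = c ^ k * Y k l x"
    "norm x ^ k * Y k l (sgn x) = Y k l x"
proof -
  have "Y k l \<in> fun_space.span (Y k ` {1..harmonic_dim TYPE('n) k})"
    using l by (intro fun_space.span_base) auto
  then have Ykl: "Y k l \<in> harmonic_homogeneous k"
    using Y by (simp add: orthonormal_harmonic_basis_def)
  show scale: "Y k l (c *\<^sub>R x) = c ^ k * Y k l x" for c x
    using Ykl by (simp add: harmonic_homogeneous_def)
  show "continuous_on S (Y k l)"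
    using Ykl by (simp add: harmonic_homogeneous_def real_polynomial_function_eq continuous_on_polymonial_function)
  \<comment> \<open>With \<open>sgn 0 = 0\<close> this includes the origin, so homogeneity gives the
    next claim there too, with \<open>0 ^ 0 = 1\<close> for \<open>k = 0\<close>.\<close>
  have "norm x *\<^sub>R sgn x = x" by (cases "x = 0") (simp_all add: sgn_div_norm)
  then show "norm x ^ k * Y k l (sgn x) = Y k l x"
    using scale[of "norm x" "sgn x"] by simp
qed

text \<open>This removes \<open>sgn\<close>, which is discontinuous at the origin, so that
  continuity of the partial sums can be read off.\<close>

lemma harmonic_partial_sum_eq:
  fixes Y :: "nat \<Rightarrow> nat \<Rightarrow> real^'n::finite \<Rightarrow> real"
  assumes "orthonormal_harmonic_basis Y"
  shows "harmonic_partial_sum Y c K x =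
    (\<Sum>k<K. \<Sum>l=1..harmonic_dim TYPE('n) k. c k l ((norm x)\<^sup>2) * Y k l x)"
  unfolding harmonic_partial_sum_def
  by (intro sum.cong refl) (simp add: orthonormal_harmonic_basisD(3)[OF assms] mult.assoc)

lemma borel_measurable_sphere_measure:
  "continuous_on (sphere 0 1) u \<Longrightarrow> u \<in> borel_measurable sphere_measure"
  by (subst measurable_cong_sets[OF sets_sphere_measure refl]) (rule borel_measurable_continuous_on_restrict)

lemma nn_integral_orthonormal_harmonic_basis:
  fixes Y :: "nat \<Rightarrow> nat \<Rightarrow> real^'n::finite \<Rightarrow> real"
  assumes Y: "orthonormal_harmonic_basis Y" and l: "l \<in> {1..harmonic_dim TYPE('n) k}"
  shows "(\<integral>\<^sup>+\<theta>. ennreal ((Y k l \<theta>)\<^sup>2) \<partial>sphere_measure) =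
    ennreal (measure (sphere_measure :: (real^'n) measure) (sphere 0 1))"
proof -
  let ?m = "measure (sphere_measure :: (real^'n) measure) (sphere 0 1)"
  obtain B where "\<And>x. x \<in> sphere 0 1 \<Longrightarrow> norm (Y k l x) \<le> B"
    using continuous_on_compact_bound[OF compact_sphere orthonormal_harmonic_basisD(1)[OF Y l]] by metis
  then have "square_integrable sphere_measure (Y k l)"
    by (intro square_integrable_bounded finite_measure_sphere_measure borel_measurable_sphere_measure
      orthonormal_harmonic_basisD(1)[OF Y l]) auto
  then have "(\<integral>\<^sup>+\<theta>. ennreal ((Y k l \<theta>)\<^sup>2) \<partial>sphere_measure) = ennreal (\<integral>\<theta>. (Y k l \<theta>)\<^sup>2 \<partial>sphere_measure)"
    by (intro nn_integral_eq_integral) (auto simp: square_integrable_def)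
  moreover have "(\<integral>\<theta>. (Y k l \<theta>)\<^sup>2 \<partial>sphere_measure) / ?m = 1"
    using Y l by (simp add: orthonormal_harmonic_basis_def sphere_inner_def power2_eq_square)
  \<comment> \<open>Division by zero yields 0, so a quotient equal to 1 already shows
    \<open>?m\<close> to be nonzero.\<close>
  then have "(\<integral>\<theta>. (Y k l \<theta>)\<^sup>2 \<partial>sphere_measure) = ?m"
    by (auto simp: divide_eq_1_iff)
  ultimately show ?thesis by simp
qed

text \<open>The coefficients \<open>e i\<close> vary with the point, as they do on the ball. One
  factor \<open>card I\<close> comes from the Cauchy-Schwarz inequality, another from adding the
  integrals, and \<open>D\<close> bounds both.\<close>

lemma nn_integral_square_sum_bound:
  fixes y e :: "'i \<Rightarrow> 'a \<Rightarrow> real"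
  assumes y [measurable]: "\<And>i. i \<in> I \<Longrightarrow> y i \<in> borel_measurable M"
    and I: "real (card I) \<le> D" and W: "W \<ge> 0" and E: "E \<ge> 0"
    and e: "\<And>i x. i \<in> I \<Longrightarrow> x \<in> space M \<Longrightarrow> \<bar>e i x\<bar> \<le> E"
    and le: "\<And>i. i \<in> I \<Longrightarrow> (\<integral>\<^sup>+x. ennreal ((y i x)\<^sup>2) \<partial>M) \<le> ennreal (W * b\<^sup>2)"
  shows "(\<integral>\<^sup>+x. ennreal ((\<Sum>i\<in>I. e i x * y i x)\<^sup>2) \<partial>M) \<le> ennreal (W * (D * E * b)\<^sup>2)"
proof -
  let ?c = "real (card I)"
  have "(\<integral>\<^sup>+x. ennreal ((\<Sum>i\<in>I. e i x * y i x)\<^sup>2) \<partial>M) \<le>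
      (\<integral>\<^sup>+x. ennreal (?c * E\<^sup>2) * (\<Sum>i\<in>I. ennreal ((y i x)\<^sup>2)) \<partial>M)"
  proof (rule nn_integral_mono)
    fix x assume x: "x \<in> space M"
    have "(\<Sum>i\<in>I. e i x * y i x)\<^sup>2 \<le> (\<Sum>i\<in>I. (e i x * y i x)\<^sup>2) * ?c"
      by (rule sum_squared_le_sum_of_squares)
    also have "\<dots> \<le> (\<Sum>i\<in>I. E\<^sup>2 * (y i x)\<^sup>2) * ?c"
      using power_mono[OF e[OF _ x] abs_ge_zero, of _ 2]
      by (intro mult_right_mono sum_mono) (auto simp: power_mult_distrib intro!: mult_right_mono)
    also have "\<dots> = ?c * E\<^sup>2 * (\<Sum>i\<in>I. (y i x)\<^sup>2)"
      by (simp add: sum_distrib_left[symmetric] mult.commute mult.left_commute)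
    finally have "ennreal ((\<Sum>i\<in>I. e i x * y i x)\<^sup>2) \<le> ennreal (?c * E\<^sup>2 * (\<Sum>i\<in>I. (y i x)\<^sup>2))"
      by (rule ennreal_leI)
    then show "ennreal ((\<Sum>i\<in>I. e i x * y i x)\<^sup>2) \<le> ennreal (?c * E\<^sup>2) * (\<Sum>i\<in>I. ennreal ((y i x)\<^sup>2))"
      by (simp add: ennreal_mult sum_nonneg)
  qed
  also have "\<dots> = ennreal (?c * E\<^sup>2) * (\<Sum>i\<in>I. \<integral>\<^sup>+x. ennreal ((y i x)\<^sup>2) \<partial>M)"
    by (subst nn_integral_cmult) (auto simp: nn_integral_sum simp del: sum_ennreal)
  also have "\<dots> \<le> ennreal (?c * E\<^sup>2) * (\<Sum>i\<in>I. ennreal (W * b\<^sup>2))"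
    by (intro mult_left_mono sum_mono le) auto
  also have "\<dots> = ennreal (?c * E\<^sup>2) * ennreal (?c * (W * b\<^sup>2))"
    using W by (simp add: ennreal_mult ennreal_of_nat_eq_real_of_nat)
  also have "\<dots> = ennreal (W * (?c * E * b)\<^sup>2)"
    using W by (subst ennreal_mult[symmetric]) (simp_all, simp add: power2_eq_square ac_simps)
  also have "\<dots> \<le> ennreal (W * (D * E * b)\<^sup>2)"
    using I W E by (intro ennreal_leI mult_left_mono) (auto simp: power_mult_distrib intro!: mult_right_mono power_mono)
  finally show ?thesis .
qed

section \<open>The polyharmonic interpolant\<close>

text \<open>The map \<open>\<phi>\<close> covers both uses: the scaling of the unit sphere to radius
  \<open>r\<close>, and the identity on the ball. As \<open>g\<close> involves neither
  \<open>M\<close> nor \<open>\<phi>\<close>, the same pointwise function is the limit in all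
  cases.\<close>

lemma harmonic_series_L2:
  fixes Y :: "nat \<Rightarrow> nat \<Rightarrow> real^'n::finite \<Rightarrow> real" and \<phi> :: "'a \<Rightarrow> real^'n"
  assumes Y: "orthonormal_harmonic_basis Y" and R: "R > 0"
    and M: "finite_measure M" and \<phi>: "\<And>x. x \<in> space M \<Longrightarrow> \<phi> x \<in> cball 0 R"
    and meas: "\<And>u :: real^'n \<Rightarrow> real. continuous_on (cball 0 R) u \<Longrightarrow> (\<lambda>x. u (\<phi> x)) \<in> borel_measurable M"
    and YW: "\<And>k l. l \<in> {1..harmonic_dim TYPE('n) k} \<Longrightarrow>
      (\<integral>\<^sup>+x. ennreal ((Y k l (\<phi> x))\<^sup>2) \<partial>M) \<le> ennreal (W * (R ^ k)\<^sup>2)"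
    and W: "W \<ge> 0"
    and f: "continuous_on (cball 0 R) f"
    and F: "uniform_limit (cball 0 R) (harmonic_partial_sum Y c) f sequentially"
    and c: "\<And>k l. l \<in> {1..harmonic_dim TYPE('n) k} \<Longrightarrow> continuous_on {0..R\<^sup>2} (c k l)"
    and d: "\<And>k l. l \<in> {1..harmonic_dim TYPE('n) k} \<Longrightarrow> continuous_on {0..R\<^sup>2} (d k l)"
    and E: "\<And>k. E k > 0" "summable (\<lambda>k. (real k + 1) ^ CARD('n) * E k * R ^ k)"
      "\<And>k l t. l \<in> {1..harmonic_dim TYPE('n) k} \<Longrightarrow> t \<in> {0..R\<^sup>2} \<Longrightarrow> \<bar>c k l t - d k l t\<bar> \<le> E k"
  defines "g k x \<equiv> (\<Sum>l=1..harmonic_dim TYPE('n) k. (c k l ((norm x)\<^sup>2) - d k l ((norm x)\<^sup>2)) * Y k l x)"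
  shows "L2_tendsto M (\<lambda>K x. harmonic_partial_sum Y d K (\<phi> x)) (\<lambda>x. f (\<phi> x) - (\<Sum>k. g k (\<phi> x)))"
    and "L2_norm_on M (\<lambda>x. \<Sum>k. g k (\<phi> x)) \<le> sqrt W * (\<Sum>k. (real k + 1) ^ CARD('n) * E k * R ^ k)"
proof -
  have coef: "continuous_on (cball 0 R) (\<lambda>x::real^'n. u ((norm x)\<^sup>2))" if "continuous_on {0..R\<^sup>2} u" for u :: "real \<Rightarrow> real"
    by (rule continuous_on_compose2[OF that]) (auto intro!: continuous_intros power_mono)
  have sq: "square_integrable M (\<lambda>x. u (\<phi> x))" if u: "continuous_on (cball 0 R) u" for u
  proof -
    obtain B where "\<And>x. x \<in> cball 0 R \<Longrightarrow> norm (u x) \<le> B"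
      using continuous_on_compact_bound[OF compact_cball u] by metis
    then show ?thesis using \<phi> by (intro square_integrable_bounded[OF M meas[OF u]]) auto
  qed
  note YC = orthonormal_harmonic_basisD(1)[OF Y]
  have dK: "continuous_on (cball 0 R) (harmonic_partial_sum Y d K)" for K
    unfolding harmonic_partial_sum_eq[OF Y]
    by (intro continuous_on_sum continuous_on_mult coef d YC)
  have gk: "continuous_on (cball 0 R) (g k)" for k
    unfolding g_def by (intro continuous_on_sum continuous_on_mult continuous_on_diff coef c d YC)
  have FK: "uniform_limit (space M) (\<lambda>K x. harmonic_partial_sum Y c K (\<phi> x)) (\<lambda>x. f (\<phi> x)) sequentially"
    using F \<phi> unfolding uniform_limit_iff by (blast intro: eventually_mono)
  have diff: "harmonic_partial_sum Y c K (\<phi> x) - harmonic_partial_sum Y d K (\<phi> x) = (\<Sum>k<K. g k (\<phi> x))" for K x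
    unfolding harmonic_partial_sum_eq[OF Y] g_def by (simp add: sum_subtractf left_diff_distrib)
  have le: "(\<integral>\<^sup>+x. ennreal ((g k (\<phi> x))\<^sup>2) \<partial>M) \<le> ennreal (W * ((real k + 1) ^ CARD('n) * E k * R ^ k)\<^sup>2)" for k
    unfolding g_def
  proof (rule nn_integral_square_sum_bound)
    have "real (harmonic_dim TYPE('n) k) \<le> of_nat ((k + 1) ^ CARD('n))"
      by (rule of_nat_mono[OF harmonic_dim_le])
    then show "real (card {1..harmonic_dim TYPE('n) k}) \<le> (real k + 1) ^ CARD('n)"
      by (simp add: add.commute)
    show "\<bar>c k l ((norm (\<phi> x))\<^sup>2) - d k l ((norm (\<phi> x))\<^sup>2)\<bar> \<le> E k"
      if "l \<in> {1..harmonic_dim TYPE('n) k}" "x \<in> space M" for l x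
      using \<phi>[OF that(2)] by (intro E that) (auto intro: power_mono)
  qed (use W E(1) less_imp_le meas[OF YC] YW in auto)
  have a: "(real k + 1) ^ CARD('n) * E k * R ^ k > 0" for k
    using E(1) R by simp
  note * = L2_tendsto_uniform_limit_minus_series[OF M sq[OF f] sq[OF dK] FK diff meas[OF gk] a E(2) W le]
  show "L2_tendsto M (\<lambda>K x. harmonic_partial_sum Y d K (\<phi> x)) (\<lambda>x. f (\<phi> x) - (\<Sum>k. g k (\<phi> x)))"
    by (rule *(1))
  show "L2_norm_on M (\<lambda>x. \<Sum>k. g k (\<phi> x)) \<le> sqrt W * (\<Sum>k. (real k + 1) ^ CARD('n) * E k * R ^ k)"
    by (rule *(2))
qed

text \<open>Two polynomials of degree below \<open>N\<close> that agree at \<open>N\<close> nodes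
  coincide, so both functions are limits of the same partial sums. Such a limit is determined only
  almost everywhere.\<close>

lemma polyharmonic_interpolant_unique:
  fixes Y :: "nat \<Rightarrow> nat \<Rightarrow> real^'n::finite \<Rightarrow> real"
  assumes N: "N \<ge> 1" and \<rho>: "admissible_knots TYPE('n) R N \<rho>"
    and h: "polyharmonic_interpolant Y R N c \<rho> h" and h': "polyharmonic_interpolant Y R N c \<rho> h'"
  shows "(\<forall>r\<in>{0..R}. AE \<theta> in sphere_measure. h' (r *\<^sub>R \<theta>) = h (r *\<^sub>R \<theta>)) \<and>
         (AE x in restrict_space lborel (ball 0 R). h' x = h x)"
proof -
  obtain p where p: "\<And>k l. l \<in> {1..harmonic_dim TYPE('n) k} \<Longrightarrow> degree (p k l) \<le> N - 1"
      "\<And>k l j. l \<in> {1..harmonic_dim TYPE('n) k} \<Longrightarrow> j \<in> {1..N} \<Longrightarrow> poly (p k l) ((\<rho> k l j)\<^sup>2) = c k l ((\<rho> k l j)\<^sup>2)"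
    and ph: "\<forall>r\<in>{0..R}. L2_tendsto sphere_measure
           (\<lambda>K \<theta>. harmonic_partial_sum Y (\<lambda>k l. poly (p k l)) K (r *\<^sub>R \<theta>)) (\<lambda>\<theta>. h (r *\<^sub>R \<theta>))"
      "L2_tendsto (restrict_space lborel (ball 0 R)) (harmonic_partial_sum Y (\<lambda>k l. poly (p k l))) h"
    using h unfolding polyharmonic_interpolant_def by blast
  obtain q where q: "\<And>k l. l \<in> {1..harmonic_dim TYPE('n) k} \<Longrightarrow> degree (q k l) \<le> N - 1"
      "\<And>k l j. l \<in> {1..harmonic_dim TYPE('n) k} \<Longrightarrow> j \<in> {1..N} \<Longrightarrow> poly (q k l) ((\<rho> k l j)\<^sup>2) = c k l ((\<rho> k l j)\<^sup>2)"
    and qh: "\<forall>r\<in>{0..R}. L2_tendsto sphere_measure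
           (\<lambda>K \<theta>. harmonic_partial_sum Y (\<lambda>k l. poly (q k l)) K (r *\<^sub>R \<theta>)) (\<lambda>\<theta>. h' (r *\<^sub>R \<theta>))"
      "L2_tendsto (restrict_space lborel (ball 0 R)) (harmonic_partial_sum Y (\<lambda>k l. poly (q k l))) h'"
    using h' unfolding polyharmonic_interpolant_def by blast
  have "p k l = q k l" if l: "l \<in> {1..harmonic_dim TYPE('n) k}" for k l
  proof (rule poly_eqI_degree)
    note A = square_knots[OF \<rho> l]
    show "poly (p k l) x = poly (q k l) x" if "x \<in> (\<lambda>j. (\<rho> k l j)\<^sup>2) ` {1..N}" for x
      using that p(2)[OF l] q(2)[OF l] by auto
    show "degree (p k l) < card ((\<lambda>j. (\<rho> k l j)\<^sup>2) ` {1..N})"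
      "degree (q k l) < card ((\<lambda>j. (\<rho> k l j)\<^sup>2) ` {1..N})"
      unfolding A(3) using p(1)[OF l] q(1)[OF l] N by auto
  qed
  then have "harmonic_partial_sum Y (\<lambda>k l. poly (q k l)) = harmonic_partial_sum Y (\<lambda>k l. poly (p k l))"
    unfolding harmonic_partial_sum_def by (intro ext sum.cong refl) simp
  with ph qh show ?thesis by (auto intro!: L2_tendsto_unique_AE)
qed

theorem theorem2:
  fixes f :: "real^'n \<Rightarrow> real" and U :: "(real^'n) set" and R :: real and N :: nat
    and Y :: "nat \<Rightarrow> nat \<Rightarrow> real^'n \<Rightarrow> real"
    and fc :: "nat \<Rightarrow> nat \<Rightarrow> real \<Rightarrow> real"
    and \<rho> :: "nat \<Rightarrow> nat \<Rightarrow> nat \<Rightarrow> real"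
  assumes "CARD('n) \<ge> 2" and "N \<ge> 1" and "R > 0"
    and "open U" and "cball 0 R \<subseteq> U" and "smooth_on U f"
    and "orthonormal_harmonic_basis Y"
    and "harmonic_coefficients Y R f fc"
    and "admissible_knots TYPE('n) R N \<rho>"
    and "ereal R * harmonic_seminorm TYPE('n) R N fc < 1"
  shows "\<exists>h. polyharmonic_interpolant Y R N fc \<rho> h \<and>
           (\<forall>h'. polyharmonic_interpolant Y R N fc \<rho> h' \<longrightarrow>
              (\<forall>r\<in>{0..R}. AE \<theta> in sphere_measure. h' (r *\<^sub>R \<theta>) = h (r *\<^sub>R \<theta>)) \<and>
              (AE x in restrict_space lborel (ball 0 R). h' x = h x)) \<and>
           (\<forall>r\<in>{0..R}. square_integrable sphere_measure (\<lambda>\<theta>. h (r *\<^sub>R \<theta>))) \<and>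
           square_integrable (restrict_space lborel (ball 0 R)) h \<and>
           (harmonic_seminorm TYPE('n) R N fc > 0 \<longrightarrow>
              (\<exists>C>0. \<forall>r\<in>{0..R}.
                 ereal (L2_norm_on sphere_measure (\<lambda>\<theta>. f (r *\<^sub>R \<theta>) - h (r *\<^sub>R \<theta>)))
                   \<le> ereal (C * R ^ (2 * N)) * harmonic_seminorm TYPE('n) R N fc ^ (N + 1)))"
proof -
  note N = assms(2) and R = assms(3) and Y = assms(7) and \<rho> = assms(9)
  let ?L = "harmonic_seminorm TYPE('n) R N fc"
  let ?S = "sphere_measure :: (real^'n) measure" and ?B = "restrict_space lborel (ball (0::real^'n) R)"
  have fc: "smooth_within {0..R\<^sup>2} (fc k l)" if "l \<in> {1..harmonic_dim TYPE('n) k}" for k l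
    using assms(8) that by (simp add: harmonic_coefficients_def)
  have fc0: "continuous_on {0..R\<^sup>2} (fc k l)" if "l \<in> {1..harmonic_dim TYPE('n) k}" for k l
    using continuous_on_nderiv_within[OF fc[OF that], of 0] by (simp add: nderiv_within_def)
  have F: "uniform_limit (cball 0 R) (harmonic_partial_sum Y fc) f sequentially"
    using assms(8) by (simp add: harmonic_coefficients_def)
  have "continuous_on U f"
    using assms(6) by (metis Ck_on.simps(1) smooth_on_def)
  then have f: "continuous_on (cball 0 R) f" using assms(5) by (rule continuous_on_subset)
  have "\<exists>p. degree p \<le> N - 1 \<and> (\<forall>j\<in>{1..N}. poly p ((\<rho> k l j)\<^sup>2) = fc k l ((\<rho> k l j)\<^sup>2))"
    if l: "l \<in> {1..harmonic_dim TYPE('n) k}" for k l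
    using interpolation_poly_exists[of "(\<lambda>j. (\<rho> k l j)\<^sup>2) ` {1..N}" "fc k l"] square_knots[OF \<rho> l] by auto
  then have "\<forall>k l. \<exists>p. l \<in> {1..harmonic_dim TYPE('n) k} \<longrightarrow>
      degree p \<le> N - 1 \<and> (\<forall>j\<in>{1..N}. poly p ((\<rho> k l j)\<^sup>2) = fc k l ((\<rho> k l j)\<^sup>2))"
    by blast
  then obtain p where "\<forall>k l. l \<in> {1..harmonic_dim TYPE('n) k} \<longrightarrow>
      degree (p k l) \<le> N - 1 \<and> (\<forall>j\<in>{1..N}. poly (p k l) ((\<rho> k l j)\<^sup>2) = fc k l ((\<rho> k l j)\<^sup>2))"
    unfolding choice_iff by blast
  then have p: "degree (p k l) \<le> N - 1 \<and> (\<forall>j\<in>{1..N}. poly (p k l) ((\<rho> k l j)\<^sup>2) = fc k l ((\<rho> k l j)\<^sup>2))"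
    if "l \<in> {1..harmonic_dim TYPE('n) k}" for k l
    using that by blast
  obtain E where E: "\<And>k. E k > 0" "summable (\<lambda>k. (real k + 1) ^ CARD('n) * E k * R ^ k)"
    "\<And>k l t. l \<in> {1..harmonic_dim TYPE('n) k} \<Longrightarrow> t \<in> {0..R\<^sup>2} \<Longrightarrow> \<bar>fc k l t - poly (p k l) t\<bar> \<le> E k"
    by (rule interpolation_coefficients_bound[OF N R fc \<rho> assms(10) p]) ((assumption | rule that)+)
  define g where "g k x = (\<Sum>l=1..harmonic_dim TYPE('n) k.
      (fc k l ((norm x)\<^sup>2) - poly (p k l) ((norm x)\<^sup>2)) * Y k l x)" for k x
  define h where "h x = f x - (\<Sum>k. g k x)" for x
  define A where "A = (\<Sum>k. (real k + 1) ^ CARD('n) * E k * R ^ k)"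
  have A: "A \<ge> 0"
    unfolding A_def using E(1,2) R by (intro suminf_nonneg) (auto simp: less_imp_le)
  have pc: "continuous_on {0..R\<^sup>2} (poly (p k l))" for k l
    by (intro continuous_intros)
  \<comment> \<open>The premises on the measure, the map and the size of \<open>Y k l\<close> stay
    open, to be discharged once for spheres and once for the ball.\<close>
  note L2 = harmonic_series_L2[where c = fc and d = "\<lambda>k l. poly (p k l)" and f = f and E = E,
      OF Y R _ _ _ _ _ f F fc0 pc E, folded g_def, folded h_def A_def]
  define m where "m = measure ?S (sphere 0 1)"
  have m: "m \<ge> 0" by (simp add: m_def)
  note Ym = nn_integral_orthonormal_harmonic_basis[OF Y, folded m_def]
  have S: "L2_tendsto ?S (\<lambda>K \<theta>. harmonic_partial_sum Y (\<lambda>k l. poly (p k l)) K (r *\<^sub>R \<theta>)) (\<lambda>\<theta>. h (r *\<^sub>R \<theta>))"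
      "L2_norm_on ?S (\<lambda>\<theta>. \<Sum>k. g k (r *\<^sub>R \<theta>)) \<le> sqrt m * A"
    if r: "r \<in> {0..R}" for r
  proof -
    have Sr: "r *\<^sub>R \<theta> \<in> cball 0 R" if "\<theta> \<in> space ?S" for \<theta>
      using r that by simp
    have meas: "(\<lambda>\<theta>. u (r *\<^sub>R \<theta>)) \<in> borel_measurable ?S" if "continuous_on (cball 0 R) u" for u :: "real^'n \<Rightarrow> real"
      by (intro borel_measurable_sphere_measure continuous_on_compose2[OF that])
        (use r in \<open>auto intro!: continuous_intros\<close>)
    \<comment> \<open>Homogeneity produces \<open>r ^ k\<close>; enlarging it to
      \<open>R ^ k\<close> makes the bound independent of \<open>r\<close>.\<close>
    have YS: "(\<integral>\<^sup>+\<theta>. ennreal ((Y k l (r *\<^sub>R \<theta>))\<^sup>2) \<partial>?S) \<le> ennreal (m * (R ^ k)\<^sup>2)"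
      if l: "l \<in> {1..harmonic_dim TYPE('n) k}" for k l
    proof -
      have "(\<integral>\<^sup>+\<theta>. ennreal ((Y k l (r *\<^sub>R \<theta>))\<^sup>2) \<partial>?S) = (\<integral>\<^sup>+\<theta>. ennreal ((r ^ k)\<^sup>2) * ennreal ((Y k l \<theta>)\<^sup>2) \<partial>?S)"
        by (simp add: orthonormal_harmonic_basisD(2)[OF Y l] power_mult_distrib ennreal_mult)
      also have "\<dots> = ennreal ((r ^ k)\<^sup>2) * ennreal m"
        using borel_measurable_sphere_measure[OF orthonormal_harmonic_basisD(1)[OF Y l]]
        by (subst nn_integral_cmult) (auto simp: Ym[OF l])
      also have "\<dots> \<le> ennreal ((R ^ k)\<^sup>2) * ennreal m"
        using r by (intro mult_right_mono ennreal_leI power_mono) auto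
      finally show ?thesis using m by (simp add: ennreal_mult mult.commute)
    qed
    note * = L2[OF finite_measure_sphere_measure Sr meas YS m]
    show "L2_tendsto ?S (\<lambda>K \<theta>. harmonic_partial_sum Y (\<lambda>k l. poly (p k l)) K (r *\<^sub>R \<theta>)) (\<lambda>\<theta>. h (r *\<^sub>R \<theta>))"
      by (rule *(1))
    show "L2_norm_on ?S (\<lambda>\<theta>. \<Sum>k. g k (r *\<^sub>R \<theta>)) \<le> sqrt m * A"
      by (rule *(2))
  qed
  have B: "L2_tendsto ?B (harmonic_partial_sum Y (\<lambda>k l. poly (p k l))) h"
  proof -
    have fin: "finite_measure ?B"
      using emeasure_lborel_ball_finite[of "0::real^'n" R]
      by (intro finite_measureI) (simp add: space_restrict_space emeasure_restrict_space)
    have Bc: "x \<in> cball 0 R" if "x \<in> space ?B" for x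
      using that by (simp add: space_restrict_space)
    have meas: "(\<lambda>x. u x) \<in> borel_measurable ?B" if "continuous_on (cball 0 R) u" for u :: "real^'n \<Rightarrow> real"
    proof -
      have "continuous_on (ball 0 R) u" using that ball_subset_cball by (rule continuous_on_subset)
      then have "u \<in> borel_measurable (restrict_space borel (ball 0 R))"
        by (rule borel_measurable_continuous_on_restrict)
      then show ?thesis by (simp add: measurable_def space_restrict_space sets_restrict_space)
    qed
    \<comment> \<open>The integral of \<open>(Y k l (sgn x))\<^sup>2\<close> over the ball, by
      \<open>nn_integral_ball_sgn\<close> and the normalization of \<open>Y\<close>.\<close>
    let ?W = "R ^ CARD('n) / CARD('n) * m"
    have W: "?W \<ge> 0" using R m by simp
    have YB: "(\<integral>\<^sup>+x. ennreal ((Y k l x)\<^sup>2) \<partial>?B) \<le> ennreal (?W * (R ^ k)\<^sup>2)"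
      if l: "l \<in> {1..harmonic_dim TYPE('n) k}" for k l
    proof -
      have Ymeas: "Y k l \<in> borel_measurable borel"
        by (rule borel_measurable_continuous_onI) (rule orthonormal_harmonic_basisD(1)[OF Y l])
      let ?u = "\<lambda>x. ennreal ((Y k l x)\<^sup>2)"
      have [measurable]: "ball 0 R - {0::real^'n} \<in> sets borel" by simp
      have [measurable]: "(sgn :: real^'n \<Rightarrow> _) \<in> borel_measurable borel"
        unfolding sgn_div_norm[abs_def] by measurable
      note [measurable] = Ymeas
      have "(\<integral>\<^sup>+x. ?u x \<partial>?B) = (\<integral>\<^sup>+x. ?u x * indicator (ball 0 R) x \<partial>lborel)"
        by (rule nn_integral_restrict_space) simp
      \<comment> \<open>The origin is a null set; elsewhere in the ball, homogeneity and
        \<open>norm x < R\<close> leave \<open>R ^ k\<close> times a function of the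
        direction.\<close>
      also have "\<dots> \<le> (\<integral>\<^sup>+x. ennreal ((R ^ k)\<^sup>2) * (?u (sgn x) * indicator (ball 0 R - {0}) x) \<partial>lborel)"
      proof (rule nn_integral_mono_AE)
        show "AE x in lborel. ?u x * indicator (ball 0 R) x \<le>
            ennreal ((R ^ k)\<^sup>2) * (?u (sgn x) * indicator (ball 0 R - {0}) x)"
          using AE_lborel_singleton[of "0::real^'n"]
        proof eventually_elim
          case (elim x)
          show ?case
          proof (cases "x \<in> ball 0 R")
            case True
            have "(Y k l x)\<^sup>2 = (norm x ^ k)\<^sup>2 * (Y k l (sgn x))\<^sup>2"
              by (metis orthonormal_harmonic_basisD(3)[OF Y l] power_mult_distrib)
            also have "\<dots> \<le> (R ^ k)\<^sup>2 * (Y k l (sgn x))\<^sup>2"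
              using True by (intro mult_right_mono power_mono) auto
            finally have "?u x \<le> ennreal ((R ^ k)\<^sup>2 * (Y k l (sgn x))\<^sup>2)"
              by (rule ennreal_leI)
            then show ?thesis using True elim by (simp add: ennreal_mult)
          qed simp
        qed
      qed
      also have "\<dots> = ennreal ((R ^ k)\<^sup>2) * (\<integral>\<^sup>+x. ?u (sgn x) * indicator (ball 0 R - {0}) x \<partial>lborel)"
        by (rule nn_integral_cmult) measurable
      also have "\<dots> = ennreal ((R ^ k)\<^sup>2) * (ennreal (R ^ CARD('n) / CARD('n)) * ennreal m)"
        by (subst nn_integral_ball_sgn[OF _ R]) (auto simp: Ym[OF l])
      also have "\<dots> = ennreal (?W * (R ^ k)\<^sup>2)"
        using R m by (simp add: mult.commute flip: ennreal_mult)
      finally show ?thesis .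
    qed
    show ?thesis by (rule L2(1)[OF fin Bc meas YB W])
  qed
  have h: "polyharmonic_interpolant Y R N fc \<rho> h"
    unfolding polyharmonic_interpolant_def using p S(1) B by blast
  have error: "\<exists>C>0. \<forall>r\<in>{0..R}. ereal (L2_norm_on ?S (\<lambda>\<theta>. f (r *\<^sub>R \<theta>) - h (r *\<^sub>R \<theta>)))
      \<le> ereal (C * R ^ (2 * N)) * ?L ^ (N + 1)" if pos: "?L > 0"
  proof -
    \<comment> \<open>An infinite seminorm would contradict the bound on its product with
      \<open>R\<close>.\<close>
    obtain s where s: "?L = ereal s" "s > 0"
      using pos assms(10) R by (cases ?L) auto
    \<comment> \<open>Chosen so that the right-hand side becomes the constant
      \<open>sqrt m * A + 1\<close>; the summand 1 guarantees \<open>C > 0\<close>.\<close>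
    define C where "C = (sqrt m * A + 1) / (R ^ (2 * N) * s ^ (N + 1))"
    have "C > 0" using R s m A by (auto simp: C_def intro!: divide_pos_pos add_nonneg_pos)
    moreover have "ereal (L2_norm_on ?S (\<lambda>\<theta>. f (r *\<^sub>R \<theta>) - h (r *\<^sub>R \<theta>)))
      \<le> ereal (C * R ^ (2 * N)) * ?L ^ (N + 1)" if "r \<in> {0..R}" for r
    proof -
      have "C * R ^ (2 * N) * s ^ (N + 1) = sqrt m * A + 1"
        using R s by (simp add: C_def)
      then have "ereal (C * R ^ (2 * N)) * ?L ^ (N + 1) = ereal (sqrt m * A + 1)"
        unfolding s(1) by (simp only: ereal_power times_ereal.simps(1))
      moreover have "L2_norm_on ?S (\<lambda>\<theta>. f (r *\<^sub>R \<theta>) - h (r *\<^sub>R \<theta>)) \<le> sqrt m * A + 1"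
        using S(2)[OF that] by (simp add: h_def)
      ultimately show ?thesis by simp
    qed
    ultimately show ?thesis by blast
  qed
  show ?thesis
    using h polyharmonic_interpolant_unique[OF N \<rho> h] S(1) B error
    unfolding L2_tendsto_def by blast
qed

end
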